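(* Let $f(z)=\sum_{n\geq1}a(n)e(nz)$ be a holomorphic cusp form of weight $k>2$ on $\Gamma_0(N)$, and set $a(n)=0$ for $n\leq 0$. Then, for the meromorphic continuations of the Dirichlet series involved, \[ \operatorname{Res}_{s=1}\sum_{n\geq1}\frac{\lvert a(n)\rvert^2}{n^{s+k-1}} = -\operatorname{Res}_{s=1}\sum_{n,h\geq1}\frac{a(n)\overline{a(n-h)}}{n^{s+k-1}} - \operatorname{Res}_{s=1}\sum_{n,h\geq 1}\frac{\overline{a(n)}a(n-h)}{n^{s+k-1}}. \]
   Context: $e(z)=e^{2\pi i z}$; the weight $k$ may be an integer or a half-integer (with the corresponding theta multiplier system in the half-integral case). *)

theory Defs
  imports "HOL-Complex_Analysis.Complex_Analysis" "HOL-Number_Theory.Number_Theory"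
begin

definition upper_half_plane :: "complex set" where
  "upper_half_plane = {z. Im z > 0}"

definition e :: "complex \<Rightarrow> complex" where
  "e z = exp (2 * of_real pi * \<i> * z)"

text \<open>A matrix with rows \<open>(a, b)\<close> and \<open>(c, d)\<close> is represented by \<open>(a, b, c, d)\<close>.\<close>

type_synonym mat2 = "int \<times> int \<times> int \<times> int"

definition SL2Z :: "mat2 set" where
  "SL2Z = {(a, b, c, d). a * d - b * c = 1}"

definition Gamma0 :: "nat \<Rightarrow> mat2 set" where
  "Gamma0 N = {(a, b, c, d). (a, b, c, d) \<in> SL2Z \<and> int N dvd c}"

fun moebius_act :: "mat2 \<Rightarrow> complex \<Rightarrow> complex" where
  "moebius_act (a, b, c, d) z = (of_int a * z + of_int b) / (of_int c * z + of_int d)"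

fun denom :: "mat2 \<Rightarrow> complex \<Rightarrow> complex" where
  "denom (a, b, c, d) z = of_int c * z + of_int d"

text \<open>
  The quadratic residue symbol \<open>(c/d)\<close> for odd \<open>d\<close> of either sign, in Shimura's convention:
  the Jacobi symbol \<open>(c/|d|)\<close>, with an additional sign \<open>-1\<close> when \<open>c\<close> and \<open>d\<close> are both negative.
  In particular \<open>(0/1) = (0/-1) = 1\<close>.
\<close>

definition shimura_symbol :: "int \<Rightarrow> int \<Rightarrow> int" where
  "shimura_symbol c d =
     (if c < 0 \<and> d < 0 then -1 else 1) *
     (\<Prod>p\<in>prime_factors \<bar>d\<bar>. Legendre c p ^ multiplicity p \<bar>d\<bar>)"

definition theta_eps :: "int \<Rightarrow> complex" where
  "theta_eps d = (if d mod 4 = 1 then 1 else \<i>)"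

text \<open>
  The theta multiplier on \<open>\<Gamma>\<^sub>0(4)\<close>, that is \<open>\<theta>(\<gamma>z) / \<theta>(z)\<close> for \<open>\<theta>(z) = \<Sum>\<^bsub>n\<in>\<int>\<^esub> e(n\<^sup>2z)\<close>. The square
  root has argument in \<open>(-\<pi>/2, \<pi>/2]\<close>, which is the branch of \<open>csqrt\<close>.
\<close>

fun theta_factor :: "mat2 \<Rightarrow> complex \<Rightarrow> complex" where
  "theta_factor (a, b, c, d) z =
     of_int (shimura_symbol c d) * inverse (theta_eps d) * csqrt (denom (a, b, c, d) z)"

text \<open>
  Here and below \<open>\<kappa>\<close> is twice the weight: \<open>\<kappa>\<close> even means integral weight, \<open>\<kappa>\<close> odd means weight
  in \<open>1/2 + \<int>\<close>.
\<close>

definition automorphy_factor :: "nat \<Rightarrow> mat2 \<Rightarrow> complex \<Rightarrow> complex" where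
  "automorphy_factor \<kappa> \<gamma> z =
     (if even \<kappa> then denom \<gamma> z ^ (\<kappa> div 2) else theta_factor \<gamma> z ^ \<kappa>)"

text \<open>
  Vanishing at the cusp \<open>\<alpha>\<infinity>\<close>: the function \<open>(cz + d)\<^bsup>-\<kappa>/2\<^esup> f(\<alpha>z)\<close> tends to \<open>0\<close> as \<open>Im z \<rightarrow> \<infinity>\<close>,
  uniformly in \<open>Re z\<close>. A different branch of the square root only changes it by a sign.
\<close>

definition vanishes_at_cusp :: "nat \<Rightarrow> (complex \<Rightarrow> complex) \<Rightarrow> mat2 \<Rightarrow> bool" where
  "vanishes_at_cusp \<kappa> f \<alpha> \<longleftrightarrow>
     ((\<lambda>z. f (moebius_act \<alpha> z) / csqrt (denom \<alpha> z) ^ \<kappa>) \<longlongrightarrow> 0) (filtercomap Im at_top)"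

text \<open>The theta multiplier is only defined on subgroups of \<open>\<Gamma>\<^sub>0(4)\<close>, hence \<open>4 dvd N\<close> for odd \<open>\<kappa>\<close>.\<close>

definition cusp_form :: "nat \<Rightarrow> nat \<Rightarrow> (complex \<Rightarrow> complex) \<Rightarrow> bool" where
  "cusp_form \<kappa> N f \<longleftrightarrow>
     (odd \<kappa> \<longrightarrow> 4 dvd N) \<and>
     f holomorphic_on upper_half_plane \<and>
     (\<forall>\<gamma>\<in>Gamma0 N. \<forall>z\<in>upper_half_plane. f (moebius_act \<gamma> z) = automorphy_factor \<kappa> \<gamma> z * f z) \<and>
     (\<forall>\<alpha>\<in>SL2Z. vanishes_at_cusp \<kappa> f \<alpha>)"

text \<open>
  \<open>F\<close> is a meromorphic continuation to \<open>Re s > \<sigma>\<close> of a function \<open>D\<close> that is given by a series in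
  some right half-plane. The values of \<open>D\<close> further to the left, where \<open>infsum\<close> may take its
  default value, are irrelevant.
\<close>

definition meromorphic_continuation ::
    "real \<Rightarrow> (complex \<Rightarrow> complex) \<Rightarrow> (complex \<Rightarrow> complex) \<Rightarrow> bool" where
  "meromorphic_continuation \<sigma> D F \<longleftrightarrow>
     F meromorphic_on {s. Re s > \<sigma>} \<and> (\<exists>c. \<forall>s. Re s > c \<longrightarrow> F s = D s)"

end

theory Submission
  imports Defs
begin

text \<open>
  Put \<open>A(n) = \<Sum>\<^bsub>m\<le>n\<^esub> a(m)\<close> and \<open>w = s + k - 1\<close>. Summing over \<open>h\<close> turns \<open>a(n - h)\<close> into \<open>A(n - 1)\<close>, and
  \<open>\<bar>a(n)\<bar>\<^sup>2 + a(n) cnj A(n - 1) + cnj a(n) A(n - 1) = \<bar>A(n)\<bar>\<^sup>2 - \<bar>A(n - 1)\<bar>\<^sup>2\<close>, so by partial summation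
  the three series add up to \<open>\<Sum> \<bar>A(n)\<bar>\<^sup>2 (n\<^bsup>-w\<^esup> - (n + 1)\<^bsup>-w\<^esup>)\<close>. This is holomorphic for
  \<open>Re s > 1/2\<close>, hence without residue at \<open>1\<close>, because \<open>\<Sum>\<^bsub>n\<le>X\<^esub> \<bar>A(n)\<bar>\<^sup>2\<close> is \<open>O(X\<^bsup>k+1/2\<^esup>)\<close>.

  The mean square comes from Parseval's identity for \<open>f(z) / (1 - e(z)) = \<Sum> A(n) e(nz)\<close> on the line
  \<open>Im z = y = 1/X\<close>. With \<open>\<phi>(z) = y\<^sup>k \<bar>f(z)\<bar>\<^sup>2\<close>, Hecke's bound \<open>\<phi> = O(1)\<close> and the decay
  \<open>\<phi> = O(\<bar>z\<bar>\<^sup>2/y)\<close> at the cusp \<open>0\<close> give \<open>\<bar>f(z)\<bar>\<^sup>2 / \<bar>1 - e(z)\<bar>\<^sup>2 = O(y\<^bsup>-k\<^esup> / (x\<^sup>2 + y))\<close> for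
  \<open>\<bar>x\<bar> \<le> 1/2\<close>, whose integral is \<open>O(y\<^bsup>-k-1/2\<^esup>)\<close>.
\<close>

section \<open>Exponential decay of periodic functions\<close>

lemma open_upper_half_plane: "open upper_half_plane"
  unfolding upper_half_plane_def by (rule open_halfspace_Im_gt)

lemma convex_upper_half_plane: "convex upper_half_plane"
  unfolding upper_half_plane_def by (rule convex_halfspace_Im_gt)

lemma norm_e: "norm (e z) = exp (- (2 * pi * Im z))"
  by (simp add: e_def norm_exp_eq_Re)

lemma e_add: "e (z + w) = e z * e w"
  by (simp add: e_def algebra_simps exp_add)

lemma e_of_int [simp]: "e (of_int m) = 1"
  unfolding e_def
  by (subst exp_eq_1) (auto intro!: exI[of _ m])

lemma e_Ln_div: "q \<noteq> 0 \<Longrightarrow> e (Ln q / (2 * of_real pi * \<i>)) = q"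
  by (simp add: e_def)

text \<open>Only moduli are known to be periodic, so the multiplier of the translation has to be
  recovered. Near a point where \<open>G\<close> does not vanish, the quotient of the two sides is
  holomorphic of modulus 1, hence constant by the maximum modulus principle; the identity theorem
  carries the relation to the whole half-plane.\<close>

lemma unimodular_quasi_period:
  fixes G :: "complex \<Rightarrow> complex" and N :: real
  assumes G: "G holomorphic_on upper_half_plane"
    and per: "\<And>w. w \<in> upper_half_plane \<Longrightarrow> norm (G (w + of_real N)) = norm (G w)"
  obtains v where "norm v = 1" "\<And>w. w \<in> upper_half_plane \<Longrightarrow> G (w + of_real N) = v * G w"
proof (cases "\<forall>w\<in>upper_half_plane. G w = 0")
  case True
  have "w + of_real N \<in> upper_half_plane" if "w \<in> upper_half_plane" for w
    using that by (simp add: upper_half_plane_def)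
  with True show ?thesis by (intro that[of 1]) auto
next
  case False
  then obtain w0 where w0: "w0 \<in> upper_half_plane" "G w0 \<noteq> 0" by blast
  have shift: "w + of_real N \<in> upper_half_plane" if "w \<in> upper_half_plane" for w
    using that by (simp add: upper_half_plane_def)
  have G1: "(\<lambda>w. G (w + of_real N)) holomorphic_on upper_half_plane"
    by (rule holomorphic_on_compose_gen[OF _ G, unfolded o_def])
       (auto intro!: holomorphic_intros shift)
  have cont: "continuous_on upper_half_plane G" by (rule holomorphic_on_imp_continuous_on[OF G])
  have "\<forall>\<^sub>F w in at w0 within upper_half_plane. G w \<noteq> 0"
    using cont w0 by (intro tendsto_imp_eventually_ne[of G "G w0"]) (auto simp: continuous_on_def)
  hence "\<forall>\<^sub>F w in nhds w0. G w \<noteq> 0"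
    using w0 open_upper_half_plane
    by (metis at_within_open eventually_nhds_conv_at)
  then obtain r1 where r1: "r1 > 0" "\<And>w. dist w w0 < r1 \<Longrightarrow> G w \<noteq> 0"
    by (auto simp: eventually_nhds_metric)
  obtain r2 where r2: "r2 > 0" "ball w0 r2 \<subseteq> upper_half_plane"
    using w0 open_upper_half_plane open_contains_ball by blast
  define B where "B = ball w0 (min r1 r2)"
  have B: "open B" "connected B" "w0 \<in> B" "B \<subseteq> upper_half_plane" "\<And>w. w \<in> B \<Longrightarrow> G w \<noteq> 0"
    using r1 r2 by (auto simp: B_def dist_commute)
  define q where "q = (\<lambda>w. G (w + of_real N) / G w)"
  have q: "q holomorphic_on B"
    unfolding q_def using B by (intro holomorphic_intros holomorphic_on_subset[OF G] holomorphic_on_subset[OF G1]) auto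
  have nq: "norm (q w) = 1" if "w \<in> B" for w
    using B per[of w] that by (auto simp: q_def norm_divide)
  have "q constant_on B"
    by (rule maximum_modulus_principle[OF q B(1,2) B(1) order_refl B(3)]) (auto simp: nq B)
  then obtain v where v: "\<And>w. w \<in> B \<Longrightarrow> q w = v" by (auto simp: constant_on_def)
  show ?thesis
  proof (rule that[of v])
    show "norm v = 1" using nq[OF B(3)] v[OF B(3)] by simp
    fix w assume w: "w \<in> upper_half_plane"
    show "G (w + of_real N) = v * G w"
    proof (rule analytic_continuation_open[of B upper_half_plane "\<lambda>w. G (w + of_real N)" "\<lambda>w. v * G w"])
      show "connected upper_half_plane" by (intro convex_connected convex_upper_half_plane)
      show "G (z + of_real N) = v * G z" if "z \<in> B" for z
        using v[OF that] B(5)[OF that] by (simp add: q_def field_simps)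
    qed (use B w0 w G G1 open_upper_half_plane in \<open>auto intro!: holomorphic_intros\<close>)
  qed
qed

text \<open>\<open>P\<close> is \<open>K\<close> composed with a rescaled logarithm. The choice of
  branch does not affect its values: changing a logarithm by a multiple of 2 pi i shifts the
  argument of \<open>K\<close> by a multiple of the period.\<close>

lemma holomorphic_through_exponential:
  fixes K :: "complex \<Rightarrow> complex" and N :: real
  assumes N: "N > 0" and K: "K holomorphic_on upper_half_plane"
    and per: "\<And>w. w \<in> upper_half_plane \<Longrightarrow> K (w + of_real N) = K w"
  obtains P where "P holomorphic_on (ball 0 1 - {0})"
    "\<And>w. w \<in> upper_half_plane \<Longrightarrow> K w = P (e (w / of_real N))"
proof -
  define c where "c = of_real N / (2 * of_real pi * \<i>)"
  have c: "c \<noteq> 0" using N by (simp add: c_def)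
  have Imc: "Im (c * u) = - N / (2 * pi) * Re u" for u
    by (simp add: c_def complex_eq_iff Im_divide power2_eq_square)
  have uhp_c: "c * u \<in> upper_half_plane \<longleftrightarrow> Re u < 0" for u
    using N unfolding upper_half_plane_def mem_Collect_eq Imc
    by (auto simp: field_simps mult_less_0_iff)
  have pern: "K (w + of_real N * of_nat n) = K w" if "w \<in> upper_half_plane" for w n
  proof (induction n)
    case (Suc n)
    have "w + of_real N * of_nat n \<in> upper_half_plane"
      using that by (simp add: upper_half_plane_def)
    from per[OF this] Suc show ?case by (simp add: algebra_simps)
  qed auto
  have peri: "K (w + of_real N * of_int m) = K w" if w: "w \<in> upper_half_plane" for w m
  proof (cases "m \<ge> 0")
    case True
    thus ?thesis using pern[OF w, of "nat m"] by simp
  next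
    case False
    have "w + of_real N * of_int m \<in> upper_half_plane"
      using w by (simp add: upper_half_plane_def)
    from pern[OF this, of "nat (-m)"] False show ?thesis by (simp add: algebra_simps)
  qed
  have same: "K (c * u) = K (c * u')" if uu: "exp u = exp u'" "Re u < 0" for u u'
  proof -
    obtain m :: int where m: "u = u' + of_real (of_int (2 * m) * pi) * \<i>"
      using uu(1) unfolding exp_eq by blast
    have "c * u = c * u' + of_real N * of_int m"
      using N by (simp add: m c_def field_simps)
    moreover have "c * u' \<in> upper_half_plane"
      using uu m unfolding uhp_c by simp
    ultimately show ?thesis using peri by simp
  qed
  define P where "P = (\<lambda>q. K (c * Ln q))"
  have Re_Ln_neg: "Re (Ln q) < 0" if "q \<in> ball 0 1 - {0}" for q
    using that by (simp add: Re_Ln)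
  \<comment> \<open>Holomorphy at \<open>q0\<close> is checked with a branch \<open>L\<close> of the
    logarithm centred at \<open>q0\<close>, which also covers the negative axis, where
    \<open>Ln\<close> jumps.\<close>
  have PU: "P field_differentiable at q0" if q0: "q0 \<in> ball 0 1 - {0}" for q0
  proof -
    define L where "L = (\<lambda>q. Ln (q / q0) + Ln q0)"
    define U where "U = (ball 0 1 - {0}) \<inter> {q. 0 < Re (q / q0)}"
    have "open U"
      unfolding U_def using q0
      by (intro open_Int open_delete open_ball open_Collect_less continuous_intros) auto
    have "q0 \<in> U" using q0 by (simp add: U_def)
    have expL: "exp (L q) = q" if "q \<in> U" for q
      using that q0 by (auto simp: L_def U_def exp_add)
    have "q / q0 \<notin> \<real>\<^sub>\<le>\<^sub>0" if "q \<in> U" for q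
      using that by (auto simp: U_def complex_nonpos_Reals_iff)
    hence L: "L holomorphic_on U"
      unfolding L_def using q0 by (intro holomorphic_intros) auto
    have ReL: "Re (L q) < 0" if "q \<in> U" for q
    proof -
      have "exp (Re (L q)) = norm q"
        using expL[OF that] by (metis norm_exp_eq_Re)
      also have "\<dots> < 1" using that by (simp add: U_def)
      finally show ?thesis by simp
    qed
    have "(\<lambda>q. K (c * L q)) holomorphic_on U"
      by (rule holomorphic_on_compose_gen[OF _ K, unfolded o_def])
         (auto intro!: holomorphic_intros L simp: uhp_c ReL)
    moreover have "K (c * L q) = P q" if "q \<in> U" for q
      unfolding P_def
      by (rule same) (use expL[OF that] ReL[OF that] that in \<open>auto simp: U_def\<close>)
    ultimately have "P holomorphic_on U"
      using holomorphic_transform by blast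
    thus ?thesis using \<open>open U\<close> \<open>q0 \<in> U\<close>
      by (auto simp: holomorphic_on_open field_differentiable_def)
  qed
  show ?thesis
  proof (rule that[of P])
    show "P holomorphic_on (ball 0 1 - {0})"
      using PU by (auto simp: holomorphic_on_def field_differentiable_at_within)
    fix w assume w: "w \<in> upper_half_plane"
    have "2 * of_real pi * \<i> * (w / of_real N) = w / c" using N by (simp add: c_def)
    hence ew: "e (w / of_real N) = exp (w / c)" by (simp only: e_def)
    have "K (c * (w / c)) = K (c * Ln (exp (w / c)))"
      by (rule same) (use w c uhp_c[of "w / c"] in auto)
    thus "K w = P (e (w / of_real N))" using c by (simp add: ew P_def)
  qed
qed

text \<open>
  With \<open>G(w + N) = e(\<theta>) G(w)\<close> and \<open>0 < \<theta> \<le> 1\<close>, the function \<open>G(w) e(-\<theta>w/N)\<close> is a function of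
  \<open>q = e(w/N)\<close> that is \<open>o(1/q)\<close> at \<open>q = 0\<close>, hence bounded there; \<open>G\<close> is then \<open>O(\<bar>q\<bar>\<^sup>\<theta>)\<close>.
\<close>

lemma exponential_decay_at_infinity:
  fixes G :: "complex \<Rightarrow> complex" and N y0 :: real
  assumes N: "N > 0" and y0: "y0 > 0"
    and G: "G holomorphic_on upper_half_plane"
    and per: "\<And>w. w \<in> upper_half_plane \<Longrightarrow> norm (G (w + of_real N)) = norm (G w)"
    and lim: "(G \<longlongrightarrow> 0) (filtercomap Im at_top)"
  obtains C \<delta> where "C \<ge> 0" "\<delta> > 0" "\<And>w. Im w \<ge> y0 \<Longrightarrow> norm (G w) \<le> C * exp (- \<delta> * Im w)"
proof -
  obtain v where v: "norm v = 1" "\<And>w. w \<in> upper_half_plane \<Longrightarrow> G (w + of_real N) = v * G w"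
    using unimodular_quasi_period[OF G per] by blast
  \<comment> \<open>\<open>Arg2pi\<close> starts at 0, so \<open>v = 1\<close> would give exponent
    0; taking 1 instead keeps the decay rate positive.\<close>
  define \<theta> where "\<theta> = (if v = 1 then 1 else Arg2pi v / (2 * pi))"
  have \<theta>: "0 < \<theta>" "\<theta> \<le> 1"
  proof -
    have "v \<noteq> 0" using v by auto
    have "Arg2pi v = 0 \<Longrightarrow> v = 1"
      using Arg2pi_eq[of v] v \<open>v \<noteq> 0\<close> by auto
    thus "0 < \<theta>" "\<theta> \<le> 1"
      using Arg2pi_ge_0[of v] Arg2pi_lt_2pi[of v] by (auto simp: \<theta>_def less_le field_simps)
  qed
  have e\<theta>: "e (of_real \<theta>) = v"
  proof (cases "v = 1")
    case True
    thus ?thesis using e_of_int[of 1] by (simp add: \<theta>_def)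
  next
    case False
    have "e (of_real \<theta>) = exp (\<i> * of_real (Arg2pi v))"
      using False by (simp add: \<theta>_def e_def mult.commute)
    thus ?thesis using Arg2pi_eq[of v] v by auto
  qed
  define K where "K = (\<lambda>w. G w * e (- of_real \<theta> * w / of_real N))"
  have K: "K holomorphic_on upper_half_plane"
    unfolding K_def e_def using N by (intro holomorphic_intros G) auto
  have Kper: "K (w + of_real N) = K w" if "w \<in> upper_half_plane" for w
  proof -
    have "- of_real \<theta> * (w + of_real N) / of_real N = - of_real \<theta> * w / of_real N + - of_real \<theta>"
      using N by (simp add: field_simps)
    moreover have "v * e (- of_real \<theta>) = 1"
      using e_add[of "of_real \<theta>" "- of_real \<theta>"] e_of_int[of 0] by (simp add: e\<theta>)
    ultimately show ?thesis unfolding K_def v(2)[OF that] by (simp only: e_add) simp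
  qed
  obtain P where P: "P holomorphic_on (ball 0 1 - {0})"
    "\<And>w. w \<in> upper_half_plane \<Longrightarrow> K w = P (e (w / of_real N))"
    using holomorphic_through_exponential[OF N K Kper] by blast
  have normK: "norm (K w) = norm (G w) * exp (2 * pi * \<theta> * Im w / N)" for w
    by (simp add: K_def norm_mult norm_e)
  have "((\<lambda>q. q * P q) \<longlongrightarrow> 0) (at 0)"
  proof (rule tendstoI)
    fix \<epsilon> :: real assume "\<epsilon> > 0"
    from tendstoD[OF lim this] obtain Y where Y: "\<And>w. Im w \<ge> Y \<Longrightarrow> norm (G w) < \<epsilon>"
      by (auto simp: eventually_filtercomap_at_top_linorder)
    have "\<forall>\<^sub>F q in at (0::complex). norm q < exp (- (2 * pi * max Y 1 / N))"
      unfolding eventually_at by (rule exI[of _ "exp (- (2 * pi * max Y 1 / N))"]) auto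
    moreover have "\<forall>\<^sub>F q in at (0::complex). q \<noteq> 0" by (rule eventually_neq_at_within)
    ultimately show "\<forall>\<^sub>F q in at 0. dist (q * P q) 0 < \<epsilon>"
    proof eventually_elim
      case (elim q)
      define w where "w = of_real N * (Ln q / (2 * of_real pi * \<i>))"
      have q: "e (w / of_real N) = q" using e_Ln_div[of q] elim N by (simp add: w_def)
      have nq: "norm q = exp (- (2 * pi * Im w / N))"
        using N by (simp add: q[symmetric] norm_e)
      have "Im w > max Y 1" using elim(1) N by (simp add: nq field_simps)
      hence w: "Im w \<ge> Y" "Im w > 0" by auto
      have "norm (P q) = norm (K w)" using P(2)[of w] w q by (simp add: upper_half_plane_def)
      hence "norm (q * P q) = norm (G w) * exp (2 * pi * \<theta> * Im w / N - 2 * pi * Im w / N)"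
        by (simp add: norm_mult nq normK exp_diff exp_minus field_simps)
      also have "\<dots> \<le> norm (G w) * 1"
        using \<theta> w N by (intro mult_left_mono) (auto simp: field_simps)
      also have "\<dots> < \<epsilon>" using Y[OF w(1)] by simp
      finally show ?case by simp
    qed
  qed
  hence "\<exists>g. g holomorphic_on ball 0 1 \<and> (\<forall>z\<in>ball 0 1 - {0}. g z = P z)"
    using P(1) by (subst holomorphic_on_extend_lim) auto
  then obtain g where g: "g holomorphic_on ball 0 1" "\<And>z. z \<in> ball 0 1 - {0} \<Longrightarrow> g z = P z" by blast
  \<comment> \<open>The region \<open>Im w \<ge> y0\<close> corresponds to 0 < |q| \<le>
    \<open>r\<close>. As \<open>r\<close> < 1, the extended function \<open>g\<close> is bounded on
    this closed disc by compactness.\<close>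
  define r where "r = exp (- (2 * pi * y0 / N))"
  have r: "0 < r" "r < 1" using N y0 by (auto simp: r_def)
  have "bounded (g ` cball 0 r)"
    using r by (intro compact_imp_bounded compact_continuous_image
      holomorphic_on_imp_continuous_on holomorphic_on_subset[OF g(1)]) auto
  then obtain C where C: "\<And>z. norm z \<le> r \<Longrightarrow> norm (g z) \<le> C"
    by (force simp: bounded_iff)
  show ?thesis
  proof (rule that)
    show "C \<ge> 0" using C[of 0] r norm_ge_zero[of "g 0"] by (smt (verit) norm_zero)
    show "2 * pi * \<theta> / N > 0" using \<theta> N by simp
    fix w assume w: "Im w \<ge> y0"
    define q where "q = e (w / of_real N)"
    have "norm q = exp (- (2 * pi * Im w / N))" using N by (simp add: q_def norm_e)
    moreover have "\<dots> \<le> r" using w N by (simp add: r_def divide_right_mono)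
    moreover have "q \<noteq> 0" by (simp add: q_def e_def)
    ultimately have "norm (P q) \<le> C" using g(2)[of q] C[of q] r by (metis DiffI dual_order.strict_trans2
        dual_order.trans mem_ball_0 singletonD not_le)
    hence "norm (K w) \<le> C" using P(2)[of w] w y0 by (simp add: upper_half_plane_def q_def)
    hence "norm (G w) * exp (2 * pi * \<theta> * Im w / N) * exp (- (2 * pi * \<theta> / N) * Im w)
        \<le> C * exp (- (2 * pi * \<theta> / N) * Im w)"
      by (intro mult_right_mono) (auto simp: normK)
    thus "norm (G w) \<le> C * exp (- (2 * pi * \<theta> / N) * Im w)"
      by (simp add: mult.assoc flip: exp_add)
  qed
qed

text \<open>The left side is largest at y = p / \<delta>, so ln x \<le> x - 1 is applied to x =
  \<delta> y / p. The resulting extra factor exp(-p) is dropped.\<close>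

lemma powr_mult_exp_le:
  fixes y p \<delta> :: real
  assumes "y > 0" "p > 0" "\<delta> > 0"
  shows "y powr p * exp (- \<delta> * y) \<le> (p / \<delta>) powr p"
proof -
  have "ln (\<delta> * y / p) \<le> \<delta> * y / p - 1" using assms by (intro ln_le_minus_one) auto
  hence "p * (ln y - ln (p / \<delta>)) \<le> p * (\<delta> * y / p)"
    using assms by (intro mult_left_mono) (auto simp: ln_mult ln_div)
  hence "p * ln y - \<delta> * y \<le> p * ln (p / \<delta>)"
    using assms by (simp add: algebra_simps)
  hence "exp (p * ln y - \<delta> * y) \<le> exp (p * ln (p / \<delta>))" by simp
  thus ?thesis using assms by (simp add: powr_def exp_diff exp_minus field_simps)
qed

section \<open>Growth of cusp forms\<close>

lemma mem_SL2Z [simp]: "(a, b, c, d) \<in> SL2Z \<longleftrightarrow> a * d - b * c = 1"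
  by (simp add: SL2Z_def)

lemma mem_Gamma0 [simp]: "(a, b, c, d) \<in> Gamma0 N \<longleftrightarrow> a * d - b * c = 1 \<and> int N dvd c"
  by (simp add: Gamma0_def)

lemma denom_nonzero:
  assumes "\<gamma> \<in> SL2Z" "z \<in> upper_half_plane"
  shows "denom \<gamma> z \<noteq> 0"
proof -
  obtain a b c d where \<gamma>: "\<gamma> = (a, b, c, d)" by (metis prod_cases4)
  have det: "a * d - b * c = 1" using assms \<gamma> by simp
  show ?thesis
  proof
    assume 0: "denom \<gamma> z = 0"
    hence "Im (denom \<gamma> z) = 0" "Re (denom \<gamma> z) = 0" by simp_all
    hence "c = 0" "d = 0" using assms(2) by (auto simp: \<gamma> upper_half_plane_def)
    thus False using det by simp
  qed
qed

lemma Im_moebius_act: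
  assumes "\<gamma> \<in> SL2Z" "z \<in> upper_half_plane"
  shows "Im (moebius_act \<gamma> z) = Im z / (norm (denom \<gamma> z))\<^sup>2"
proof -
  obtain a b c d where \<gamma>: "\<gamma> = (a, b, c, d)" by (metis prod_cases4)
  have det: "of_int a * of_int d - of_int b * of_int c = (1 :: real)"
    using assms \<gamma> by (metis mem_SL2Z of_int_1 of_int_diff of_int_mult)
  define D where "D = denom \<gamma> z"
  have "moebius_act \<gamma> z = (of_int a * z + of_int b) * cnj D / of_real ((norm D)\<^sup>2)"
    using denom_nonzero[OF assms]
    by (simp add: \<gamma> D_def complex_div_cnj[of _ "of_int c * z + of_int d"])
  hence "Im (moebius_act \<gamma> z) = Im ((of_int a * z + of_int b) * cnj D) / (norm D)\<^sup>2"
    by (simp only: Im_divide_of_real)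
  also have "Im ((of_int a * z + of_int b) * cnj D) = (of_int a * of_int d - of_int b * of_int c) * Im z"
    by (simp add: D_def \<gamma> algebra_simps)
  finally show ?thesis using det by (simp add: D_def)
qed

lemma moebius_act_in_upper_half_plane:
  assumes "\<gamma> \<in> SL2Z" "z \<in> upper_half_plane"
  shows "moebius_act \<gamma> z \<in> upper_half_plane"
  using Im_moebius_act[OF assms] denom_nonzero[OF assms] assms(2)
  by (simp add: upper_half_plane_def)

lemma moebius_act_compose:
  assumes "(a', b', c', d') \<in> SL2Z" "z \<in> upper_half_plane"
  shows "denom (a, b, c, d) (moebius_act (a', b', c', d') z) * denom (a', b', c', d') z =
           denom (a * a' + b * c', a * b' + b * d', c * a' + d * c', c * b' + d * d') z"
    and "moebius_act (a, b, c, d) (moebius_act (a', b', c', d') z) =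
           moebius_act (a * a' + b * c', a * b' + b * d', c * a' + d * c', c * b' + d * d') z"
proof -
  have nz: "of_int c' * z + of_int d' \<noteq> 0" using denom_nonzero[OF assms] by simp
  show 1: "denom (a, b, c, d) (moebius_act (a', b', c', d') z) * denom (a', b', c', d') z =
           denom (a * a' + b * c', a * b' + b * d', c * a' + d * c', c * b' + d * d') z"
    using nz by (simp add: field_simps)
  have "of_int a * moebius_act (a', b', c', d') z + of_int b =
          (of_int (a * a' + b * c') * z + of_int (a * b' + b * d')) / (of_int c' * z + of_int d')"
       "of_int c * moebius_act (a', b', c', d') z + of_int d =
          (of_int (c * a' + d * c') * z + of_int (c * b' + d * d')) / (of_int c' * z + of_int d')"
    using nz by (simp_all add: field_simps)
  thus "moebius_act (a, b, c, d) (moebius_act (a', b', c', d') z) =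
           moebius_act (a * a' + b * c', a * b' + b * d', c * a' + d * c', c * b' + d * d') z"
    using nz by (simp only: moebius_act.simps) (simp add: divide_simps)
qed

lemma moebius_act_inverse:
  assumes "(a, b, c, d) \<in> SL2Z" "z \<in> upper_half_plane"
  shows "moebius_act (d, -b, -c, a) (moebius_act (a, b, c, d) z) = z"
proof -
  have "d * a + - b * c = 1" "d * b + - b * d = 0" "- c * a + a * c = 0" "- c * b + a * d = 1"
    using assms(1) by (simp_all add: algebra_simps)
  thus ?thesis using moebius_act_compose(2)[OF assms, of d "-b" "-c" a] by simp
qed

section \<open>Modulus of the automorphy factor\<close>

text \<open>A prime dividing both \<open>c\<close> and \<open>d\<close> would divide the
  determinant, so every Legendre symbol in the product is 1 or -1.\<close>

lemma abs_shimura_symbol: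
  assumes "a * d - b * c = 1"
  shows "\<bar>shimura_symbol c d\<bar> = 1"
proof -
  have "\<bar>Legendre c p ^ multiplicity p \<bar>d\<bar>\<bar> = 1" if p: "p \<in> prime_factors \<bar>d\<bar>" for p
  proof -
    have "p dvd d" "prime p" using p by auto
    hence "\<not> p dvd c" using assms
      by (metis dvd_diff dvd_mult not_prime_unit)
    hence "\<bar>Legendre c p\<bar> = 1" by (auto simp: Legendre_def cong_0_iff)
    thus ?thesis by (simp add: power_abs)
  qed
  thus ?thesis unfolding shimura_symbol_def abs_mult abs_prod by (simp add: prod.neutral)
qed

text \<open>Signs and fourth roots of unity disappear in the modulus, and squaring removes the
  square root. From here on, integral and half-integral weights are treated alike.\<close>

lemma norm_automorphy_factor:
  assumes "\<gamma> \<in> SL2Z"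
  shows "(norm (automorphy_factor \<kappa> \<gamma> z))\<^sup>2 = norm (denom \<gamma> z) ^ \<kappa>"
proof (cases "even \<kappa>")
  case True
  thus ?thesis by (simp add: automorphy_factor_def norm_power flip: power_mult)
next
  case False
  obtain a b c d where \<gamma>: "\<gamma> = (a, b, c, d)" by (metis prod_cases4)
  have "norm (of_int (shimura_symbol c d) :: complex) = 1"
    using abs_shimura_symbol[of a d b c] assms \<gamma> by (simp flip: of_int_abs)
  moreover have "norm (inverse (theta_eps d)) = 1" by (simp add: theta_eps_def)
  moreover have "(norm (csqrt w))\<^sup>2 = norm w" for w by (metis norm_power power2_csqrt)
  ultimately have "(norm (theta_factor \<gamma> z))\<^sup>2 = norm (denom \<gamma> z)"
    by (simp add: \<gamma> norm_mult power_mult_distrib del: denom.simps)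
  thus ?thesis using False
    by (simp add: automorphy_factor_def norm_power) (metis power_commutes power_mult mult.commute)
qed

section \<open>Uniform decay of the squared slash operator at all cusps\<close>

text \<open>
  Squaring makes the denominator an integral power of \<open>cz + d\<close>, so that no branch of the square
  root is involved for half-integral weight.
\<close>

definition slash_square :: "nat \<Rightarrow> (complex \<Rightarrow> complex) \<Rightarrow> mat2 \<Rightarrow> complex \<Rightarrow> complex" where
  "slash_square \<kappa> f \<gamma> w = f (moebius_act \<gamma> w) ^ 2 / denom \<gamma> w ^ \<kappa>"

lemma holomorphic_slash_square:
  assumes "f holomorphic_on upper_half_plane" "\<gamma> \<in> SL2Z"
  shows "slash_square \<kappa> f \<gamma> holomorphic_on upper_half_plane"
proof -
  obtain a b c d where \<gamma>: "\<gamma> = (a, b, c, d)" by (metis prod_cases4)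
  have nz: "of_int c * z + of_int d \<noteq> 0" if "z \<in> upper_half_plane" for z
    using denom_nonzero[OF assms(2) that] by (simp add: \<gamma>)
  have "moebius_act \<gamma> holomorphic_on upper_half_plane"
    unfolding \<gamma> moebius_act.simps[abs_def] using nz by (intro holomorphic_intros) auto
  hence "(\<lambda>w. f (moebius_act \<gamma> w)) holomorphic_on upper_half_plane"
    using holomorphic_on_compose_gen[OF _ assms(1), unfolded o_def] moebius_act_in_upper_half_plane[OF assms(2)]
    by blast
  moreover have "denom \<gamma> holomorphic_on upper_half_plane"
    unfolding \<gamma> denom.simps[abs_def] by (intro holomorphic_intros)
  ultimately show ?thesis
    unfolding slash_square_def[abs_def] using denom_nonzero[OF assms(2)]
    by (intro holomorphic_intros) auto
qed

lemma slash_square_vanishes_at_cusp: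
  assumes "vanishes_at_cusp \<kappa> f \<gamma>"
  shows "(slash_square \<kappa> f \<gamma> \<longlongrightarrow> 0) (filtercomap Im at_top)"
proof -
  have "((\<lambda>z. (f (moebius_act \<gamma> z) / csqrt (denom \<gamma> z) ^ \<kappa>)\<^sup>2) \<longlongrightarrow> 0\<^sup>2) (filtercomap Im at_top)"
    using assms unfolding vanishes_at_cusp_def by (rule tendsto_power)
  moreover have "(f (moebius_act \<gamma> z) / csqrt (denom \<gamma> z) ^ \<kappa>)\<^sup>2 = slash_square \<kappa> f \<gamma> z" for z
  proof -
    have "(csqrt w ^ \<kappa>)\<^sup>2 = w ^ \<kappa>" for w
      by (metis mult.commute power2_csqrt power_mult)
    thus ?thesis by (simp add: slash_square_def power_divide)
  qed
  ultimately show ?thesis by simp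
qed

text \<open>Two matrices whose bottom rows agree modulo \<open>N\<close> differ by a left factor
  \<delta> in \<open>Gamma0 N\<close>, the second matrix times the inverse of the first. The
  automorphy factor of \<delta> has the modulus of a power of \<open>denom \<delta>\<close>, which
  cancels by the cocycle relation for c z + d.\<close>

lemma norm_slash_square_cong:
  assumes f: "cusp_form \<kappa> N f"
    and det: "(a, b, c, d) \<in> SL2Z" "(a', b', c', d') \<in> SL2Z"
    and cong: "[c = c'] (mod int N)" "[d = d'] (mod int N)"
    and w: "w \<in> upper_half_plane"
  shows "norm (slash_square \<kappa> f (a, b, c, d) w) = norm (slash_square \<kappa> f (a', b', c', d') w)"
proof -
  define \<delta> where "\<delta> = (a' * d - b' * c, b' * a - a' * b, c' * d - d' * c, d' * a - c' * b)"
  have dets: "a * d - b * c = 1" "a' * d' - b' * c' = 1" using det by simp_all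
  have "(a' * d - b' * c) * (d' * a - c' * b) - (b' * a - a' * b) * (c' * d - d' * c)
          = (a * d - b * c) * (a' * d' - b' * c')"
    by (simp add: algebra_simps)
  hence \<delta>SL: "\<delta> \<in> SL2Z" using dets by (simp add: \<delta>_def)
  have "[c' * d - d' * c = c * d - d * c] (mod int N)"
    by (intro cong_diff cong_mult cong_refl cong_sym[OF cong(1)] cong_sym[OF cong(2)])
  hence "int N dvd c' * d - d' * c" by (simp add: cong_0_iff mult.commute)
  with \<delta>SL have \<delta>: "\<delta> \<in> Gamma0 N" by (simp add: \<delta>_def)
  define u where "u = moebius_act (a, b, c, d) w"
  have u: "u \<in> upper_half_plane" unfolding u_def by (rule moebius_act_in_upper_half_plane[OF det(1) w])
  have prod: "(a' * d - b' * c) * a + (b' * a - a' * b) * c = a'"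
    "(a' * d - b' * c) * b + (b' * a - a' * b) * d = b'"
    "(c' * d - d' * c) * a + (d' * a - c' * b) * c = c'"
    "(c' * d - d' * c) * b + (d' * a - c' * b) * d = d'"
  proof -
    have "(a' * d - b' * c) * a + (b' * a - a' * b) * c = a' * (a * d - b * c)"
      "(a' * d - b' * c) * b + (b' * a - a' * b) * d = b' * (a * d - b * c)"
      "(c' * d - d' * c) * a + (d' * a - c' * b) * c = c' * (a * d - b * c)"
      "(c' * d - d' * c) * b + (d' * a - c' * b) * d = d' * (a * d - b * c)"
      by (simp_all add: algebra_simps)
    thus "(a' * d - b' * c) * a + (b' * a - a' * b) * c = a'"
      "(a' * d - b' * c) * b + (b' * a - a' * b) * d = b'"
      "(c' * d - d' * c) * a + (d' * a - c' * b) * c = c'"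
      "(c' * d - d' * c) * b + (d' * a - c' * b) * d = d'"
      unfolding dets(1) by simp_all
  qed
  have den: "denom \<delta> u * denom (a, b, c, d) w = denom (a', b', c', d') w"
    unfolding \<delta>_def u_def moebius_act_compose(1)[OF det(1) w] prod ..
  have "moebius_act \<delta> u = moebius_act (a', b', c', d') w"
    unfolding \<delta>_def u_def moebius_act_compose(2)[OF det(1) w] prod ..
  moreover have "f (moebius_act \<delta> u) = automorphy_factor \<kappa> \<delta> u * f u"
    using f \<delta> u by (auto simp: cusp_form_def)
  ultimately have "(norm (f (moebius_act (a', b', c', d') w)))\<^sup>2 = norm (denom \<delta> u) ^ \<kappa> * (norm (f u))\<^sup>2"
    using norm_automorphy_factor[OF \<delta>SL] by (simp add: norm_mult power_mult_distrib)
  hence "norm (slash_square \<kappa> f (a', b', c', d') w) =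
      norm (denom \<delta> u) ^ \<kappa> * (norm (f u))\<^sup>2 / norm (denom \<delta> u * denom (a, b, c, d) w) ^ \<kappa>"
    by (simp add: slash_square_def norm_divide norm_power den del: denom.simps moebius_act.simps)
  also have "\<dots> = norm (slash_square \<kappa> f (a, b, c, d) w)"
    using denom_nonzero[OF \<delta>SL u]
    by (simp add: slash_square_def norm_divide norm_power norm_mult power_mult_distrib u_def
          del: denom.simps moebius_act.simps)
  finally show ?thesis ..
qed

text \<open>Translating \<open>w\<close> by \<open>N\<close> multiplies \<gamma> on the right by (1,
  N, 0, 1), which preserves the bottom row modulo \<open>N\<close>.\<close>

lemma norm_slash_square_period:
  assumes f: "cusp_form \<kappa> N f" and \<gamma>: "\<gamma> \<in> SL2Z" and w: "w \<in> upper_half_plane"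
  shows "norm (slash_square \<kappa> f \<gamma> (w + of_real (real N))) = norm (slash_square \<kappa> f \<gamma> w)"
proof -
  obtain a b c d where g: "\<gamma> = (a, b, c, d)" by (metis prod_cases4)
  have 1: "(a, a * int N + b, c, c * int N + d) \<in> SL2Z"
    using \<gamma> by (simp add: g algebra_simps)
  have "slash_square \<kappa> f \<gamma> (w + of_real (real N)) = slash_square \<kappa> f (a, a * int N + b, c, c * int N + d) w"
    by (simp add: slash_square_def g algebra_simps)
  moreover have "norm (slash_square \<kappa> f (a, a * int N + b, c, c * int N + d) w) = norm (slash_square \<kappa> f \<gamma> w)"
    using norm_slash_square_cong[OF f 1 \<gamma>[unfolded g] _ _ w] by (simp add: g cong_def)
  ultimately show ?thesis by simp
qed

text \<open>For a single \<gamma>, exponential decay beats the power of \<open>Im w\<close>. The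
  constant can be made independent of \<gamma> because the modulus depends only on the bottom row
  modulo \<open>N\<close>, which takes finitely many values.\<close>

lemma slash_square_bound:
  assumes f: "cusp_form \<kappa> N f" and N: "N > 0" and p: "p > 0"
  obtains C where "C \<ge> 0"
    "\<And>\<gamma> w. \<gamma> \<in> SL2Z \<Longrightarrow> Im w \<ge> 1/5 \<Longrightarrow> norm (slash_square \<kappa> f \<gamma> w) * Im w powr p \<le> C"
proof -
  have single: "\<exists>C\<ge>0. \<forall>w. Im w \<ge> 1/5 \<longrightarrow> norm (slash_square \<kappa> f \<gamma> w) * Im w powr p \<le> C"
    if \<gamma>: "\<gamma> \<in> SL2Z" for \<gamma>
  proof -
    have hol: "slash_square \<kappa> f \<gamma> holomorphic_on upper_half_plane"
      using f \<gamma> by (intro holomorphic_slash_square) (auto simp: cusp_form_def)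
    have lim: "(slash_square \<kappa> f \<gamma> \<longlongrightarrow> 0) (filtercomap Im at_top)"
      using f \<gamma> by (intro slash_square_vanishes_at_cusp) (auto simp: cusp_form_def)
    obtain C \<delta> where C: "C \<ge> 0" "\<delta> > 0"
      "\<And>w. Im w \<ge> 1/5 \<Longrightarrow> norm (slash_square \<kappa> f \<gamma> w) \<le> C * exp (- \<delta> * Im w)"
      using exponential_decay_at_infinity[OF _ _ hol norm_slash_square_period[OF f \<gamma>] lim, of "1/5"] N
      by auto
    have "norm (slash_square \<kappa> f \<gamma> w) * Im w powr p \<le> C * (p / \<delta>) powr p" if "Im w \<ge> 1/5" for w
    proof -
      have "norm (slash_square \<kappa> f \<gamma> w) * Im w powr p \<le> C * exp (- \<delta> * Im w) * Im w powr p"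
        by (intro mult_right_mono C that) auto
      also have "\<dots> = C * (Im w powr p * exp (- \<delta> * Im w))" by simp
      also have "\<dots> \<le> C * (p / \<delta>) powr p"
        using that C p by (intro mult_left_mono powr_mult_exp_le) auto
      finally show ?thesis .
    qed
    thus ?thesis using C by (intro exI[of _ "C * (p / \<delta>) powr p"]) auto
  qed
  \<comment> \<open>\<open>r\<close> is the bottom row modulo \<open>N\<close>, and \<open>s\<close>
    picks one matrix for each row that occurs. The sum of the bounds of these representatives
    dominates each of them.\<close>
  define r where "r = (\<lambda>\<gamma>::mat2. case \<gamma> of (a, b, c, d) \<Rightarrow> (c mod int N, d mod int N))"
  have "r ` SL2Z \<subseteq> {0..<int N} \<times> {0..<int N}" using N by (auto simp: r_def)
  hence fin: "finite (r ` SL2Z)" by (rule finite_subset) auto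
  define s where "s = (\<lambda>x. inv_into SL2Z r x)"
  have s: "s (r \<gamma>) \<in> SL2Z" "r (s (r \<gamma>)) = r \<gamma>" if "\<gamma> \<in> SL2Z" for \<gamma>
    using that by (auto simp: s_def inv_into_into f_inv_into_f)
  obtain B where B: "\<And>\<gamma>. \<gamma> \<in> SL2Z \<Longrightarrow> B \<gamma> \<ge> 0"
    "\<And>\<gamma> w. \<gamma> \<in> SL2Z \<Longrightarrow> Im w \<ge> 1/5 \<Longrightarrow> norm (slash_square \<kappa> f \<gamma> w) * Im w powr p \<le> B \<gamma>"
    using single by metis
  show ?thesis
  proof (rule that[of "\<Sum>x\<in>r ` SL2Z. B (s x)"])
    show "0 \<le> (\<Sum>x\<in>r ` SL2Z. B (s x))" by (intro sum_nonneg) (auto intro!: B(1) s)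
    fix \<gamma> w assume \<gamma>: "\<gamma> \<in> SL2Z" and w: "Im w \<ge> 1/5"
    obtain a b c d where g: "\<gamma> = (a, b, c, d)" by (metis prod_cases4)
    obtain a' b' c' d' where g': "s (r \<gamma>) = (a', b', c', d')" by (metis prod_cases4)
    have "norm (slash_square \<kappa> f (a, b, c, d) w) = norm (slash_square \<kappa> f (a', b', c', d') w)"
      using s[OF \<gamma>, unfolded g'] \<gamma> w
      by (intro norm_slash_square_cong[OF f]) (auto simp: g g' r_def cong_def upper_half_plane_def)
    hence "norm (slash_square \<kappa> f \<gamma> w) * Im w powr p \<le> B (s (r \<gamma>))"
      using B(2)[OF s(1)[OF \<gamma>] w] g g' by simp
    also have "\<dots> \<le> (\<Sum>x\<in>r ` SL2Z. B (s x))"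
      by (rule member_le_sum) (use \<gamma> fin in \<open>auto intro!: B(1) s\<close>)
    finally show "norm (slash_square \<kappa> f \<gamma> w) * Im w powr p \<le> (\<Sum>x\<in>r ` SL2Z. B (s x))" .
  qed
qed

section \<open>The height function Im(z)^k |f(z)|^2\<close>

lemma invariant_height_moebius:
  assumes "\<gamma> \<in> SL2Z" "w \<in> upper_half_plane"
  shows "(norm (f (moebius_act \<gamma> w)))\<^sup>2 * Im (moebius_act \<gamma> w) powr (real \<kappa> / 2) =
           norm (slash_square \<kappa> f \<gamma> w) * Im w powr (real \<kappa> / 2)"
proof -
  define D where "D = norm (denom \<gamma> w)"
  have D: "D > 0" using denom_nonzero[OF assms] by (simp add: D_def)
  have "(D\<^sup>2) powr (real \<kappa> / 2) = D ^ \<kappa>"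
    using D by (simp add: powr_powr flip: powr_realpow powr_numeral)
  hence "Im (moebius_act \<gamma> w) powr (real \<kappa> / 2) = Im w powr (real \<kappa> / 2) / D ^ \<kappa>"
    using D assms(2) by (simp add: Im_moebius_act[OF assms] D_def powr_divide upper_half_plane_def)
  thus ?thesis by (simp add: slash_square_def norm_divide norm_power D_def)
qed

text \<open>Dirichlet approximation replaces reduction to a fundamental domain. With
  \<open>M\<close> of size about 1 / sqrt y and |q x - h| < 1/M, q \<le> M, one gets |q z - h|^2
  \<le> 1/M^2 + (M y)^2 \<le> y + 4 y, hence the constant 1/5.\<close>

lemma exists_SL2Z_Im_ge:
  assumes z: "z \<in> upper_half_plane"
  obtains \<gamma> where "\<gamma> \<in> SL2Z" "Im (moebius_act \<gamma> z) \<ge> 1/5"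
proof (cases "Im z \<ge> 1")
  case True
  show ?thesis by (rule that[of "(1, 0, 0, 1)"]) (use True in auto)
next
  case False
  define y where "y = Im z"
  have y: "0 < y" "y < 1" using False z by (auto simp: y_def upper_half_plane_def)
  define M where "M = nat \<lceil>1 / sqrt y\<rceil>"
  have sq: "0 < sqrt y" "sqrt y < 1" "(sqrt y)\<^sup>2 = y" using y by auto
  have M1: "1 / sqrt y \<le> real M" unfolding M_def using sq by linarith
  have M2: "real M \<le> 2 / sqrt y"
  proof -
    have "1 / sqrt y \<ge> 1" using sq by simp
    moreover from this have "real M \<le> 1 / sqrt y + 1" unfolding M_def by linarith
    ultimately have "real M \<le> 1 / sqrt y + 1 / sqrt y" by linarith
    thus ?thesis by simp
  qed
  have M0: "M > 0" using M1 sq by (smt (verit) divide_pos_pos gr0I of_nat_0)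
  obtain h q where hq: "coprime h q" "0 < q" "q \<le> int M" "\<bar>of_int q * Re z - of_int h\<bar> < 1 / real M"
    using Dirichlet_approx_coprime[OF M0] by blast
  have "gcd q h = 1" using hq(1) by (simp add: coprime_commute)
  then obtain u v where uv: "u * q + v * h = 1" using bezout_int[of q h] by auto
  \<comment> \<open>The bottom row (q, -h) is completed to determinant 1 by the Bezout
    relation.\<close>
  define \<gamma> where "\<gamma> = (- v, - u, q, - h)"
  have \<gamma>: "\<gamma> \<in> SL2Z" using uv by (simp add: \<gamma>_def algebra_simps)
  have "(norm (denom \<gamma> z))\<^sup>2 = (of_int q * Re z - of_int h)\<^sup>2 + (of_int q * y)\<^sup>2"
    by (simp add: \<gamma>_def cmod_power2 y_def)
  also have "\<dots> \<le> (1 / real M)\<^sup>2 + (real M * y)\<^sup>2"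
  proof (rule add_mono)
    show "(of_int q * Re z - of_int h)\<^sup>2 \<le> (1 / real M)\<^sup>2"
      using power_mono[of "\<bar>of_int q * Re z - of_int h\<bar>" "1 / real M" 2] hq by simp
    show "(of_int q * y)\<^sup>2 \<le> (real M * y)\<^sup>2"
      using hq y by (intro power_mono mult_right_mono) auto
  qed
  also have "\<dots> \<le> (sqrt y)\<^sup>2 + (2 / sqrt y * y)\<^sup>2"
    using M1 M2 M0 sq y by (intro add_mono power_mono mult_right_mono) (auto simp: field_simps)
  also have "\<dots> = 5 * y" using y sq by (simp add: power_mult_distrib power_divide power2_eq_square)
  finally have "(norm (denom \<gamma> z))\<^sup>2 \<le> 5 * y" .
  moreover have "(norm (denom \<gamma> z))\<^sup>2 > 0" using denom_nonzero[OF \<gamma> z] by simp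
  ultimately show ?thesis
    using y by (intro that[OF \<gamma>]) (simp add: Im_moebius_act[OF \<gamma> z] field_simps flip: y_def)
qed

lemma cusp_form_height_bounds:
  assumes f: "cusp_form \<kappa> N f" and N: "N > 0" and \<kappa>: "\<kappa> > 0"
  obtains C where "C \<ge> 0"
    "\<And>z. z \<in> upper_half_plane \<Longrightarrow> (norm (f z))\<^sup>2 * Im z powr (real \<kappa> / 2) \<le> C"
    "\<And>z. z \<in> upper_half_plane \<Longrightarrow> (norm (f z))\<^sup>2 * Im z powr (real \<kappa> / 2) \<le> C * ((norm z)\<^sup>2 / Im z)"
proof -
  define k where "k = real \<kappa> / 2"
  have k: "k > 0" using \<kappa> by (simp add: k_def)
  obtain C1 where C1: "C1 \<ge> 0"
    "\<And>\<gamma> w. \<gamma> \<in> SL2Z \<Longrightarrow> Im w \<ge> 1/5 \<Longrightarrow> norm (slash_square \<kappa> f \<gamma> w) * Im w powr k \<le> C1"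
    using slash_square_bound[OF f N k] by blast
  \<comment> \<open>The additional power of \<open>Im w\<close> yields the factor 1 / Im w = |z|^2 /
    Im z in the bound near the cusp 0, where w = -1/z.\<close>
  obtain C2 where C2: "C2 \<ge> 0"
    "\<And>\<gamma> w. \<gamma> \<in> SL2Z \<Longrightarrow> Im w \<ge> 1/5 \<Longrightarrow> norm (slash_square \<kappa> f \<gamma> w) * Im w powr (k + 1) \<le> C2"
    using slash_square_bound[OF f N, of "k + 1"] k by auto
  have b1: "(norm (f z))\<^sup>2 * Im z powr k \<le> C1" if z: "z \<in> upper_half_plane" for z
  proof -
    obtain \<gamma> where \<gamma>: "\<gamma> \<in> SL2Z" "Im (moebius_act \<gamma> z) \<ge> 1/5" using exists_SL2Z_Im_ge[OF z] by blast
    obtain a b c d where g: "\<gamma> = (a, b, c, d)" by (metis prod_cases4)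
    define w where "w = moebius_act \<gamma> z"
    have w: "w \<in> upper_half_plane" unfolding w_def by (rule moebius_act_in_upper_half_plane[OF \<gamma>(1) z])
    \<comment> \<open>The point z is the image of the high point \<open>w\<close> under the inverse
      matrix, so the uniform bound is applied to that inverse.\<close>
    have i: "(d, -b, -c, a) \<in> SL2Z" using \<gamma>(1) by (simp add: g algebra_simps)
    have "moebius_act (d, -b, -c, a) w = z"
      unfolding w_def g using \<gamma>(1) z by (intro moebius_act_inverse) (auto simp: g)
    thus ?thesis
      using invariant_height_moebius[OF i w, of f \<kappa>] C1(2)[OF i] \<gamma>(2) by (simp add: k_def w_def)
  qed
  have b2: "(norm (f z))\<^sup>2 * Im z powr k \<le> (5 * C1 + C2) * ((norm z)\<^sup>2 / Im z)" if z: "z \<in> upper_half_plane" for z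
  proof -
    have S: "(0, -1, 1, 0) \<in> SL2Z" by simp
    define w where "w = moebius_act (0, -1, 1, 0) z"
    have w: "w \<in> upper_half_plane" unfolding w_def by (rule moebius_act_in_upper_half_plane[OF S z])
    have Imw: "Im w = Im z / (norm z)\<^sup>2" using Im_moebius_act[OF S z] by (simp add: w_def)
    have Imw0: "Im w > 0" using w by (simp add: upper_half_plane_def)
    have z0: "z \<noteq> 0" using z by (auto simp: upper_half_plane_def)
    have zw: "moebius_act (0, -1, 1, 0) w = z" using z0 by (simp add: w_def)
    have inv: "(norm z)\<^sup>2 / Im z = 1 / Im w" by (simp add: Imw)
    show ?thesis
    proof (cases "Im w \<ge> 1/5")
      case True
      have "(norm (f z))\<^sup>2 * Im z powr k = norm (slash_square \<kappa> f (0, -1, 1, 0) w) * Im w powr k"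
        using invariant_height_moebius[OF S w, of f \<kappa>] by (simp only: zw k_def)
      also have "\<dots> = norm (slash_square \<kappa> f (0, -1, 1, 0) w) * Im w powr (k + 1) / Im w"
        using Imw0 by (simp add: powr_add)
      also have "\<dots> \<le> C2 / Im w" using C2(2)[OF S True] Imw0 by (intro divide_right_mono) auto
      also have "\<dots> \<le> (5 * C1 + C2) / Im w" using C1(1) Imw0 by (intro divide_right_mono) auto
      finally show ?thesis unfolding inv by simp
    next
      \<comment> \<open>For Im w < 1/5 the factor 1 / Im w exceeds 5, so the first bound already
        suffices; this explains the constant 5 * C1.\<close>
      case False
      have "(norm (f z))\<^sup>2 * Im z powr k \<le> C1" by (rule b1[OF z])
      also have "\<dots> \<le> 5 * C1 * (1 / 5) / Im w" using False C1(1) Imw0 by (simp add: field_simps mult_left_le)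
      also have "\<dots> \<le> (5 * C1 + C2) / Im w" using C1(1) C2(1) Imw0 by (intro divide_right_mono) auto
      finally show ?thesis unfolding inv by simp
    qed
  qed
  show ?thesis
  proof (rule that[of "5 * C1 + C2"])
    show "(norm (f z))\<^sup>2 * Im z powr (real \<kappa> / 2) \<le> 5 * C1 + C2" if "z \<in> upper_half_plane" for z
      using b1[OF that] C1(1) C2(1) by (simp add: k_def)
  qed (use b2 C1(1) C2(1) in \<open>auto simp: k_def\<close>)
qed

section \<open>Mean square of the partial sums of the coefficients\<close>

lemma has_integral_e_of_int:
  "((\<lambda>x. e (of_int j * of_real x)) has_integral (if j = 0 then 1 else 0)) {-1/2..1/2::real}"
proof (cases "j = 0")
  case True
  thus ?thesis using has_integral_const_real[of "1::complex" "-1/2" "1/2"] by (simp add: e_def)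
next
  case False
  define F where "F = (\<lambda>z. e (of_int j * z) / (2 * of_real pi * \<i> * of_int j))"
  have nz: "2 * of_real pi * \<i> * of_int j \<noteq> (0::complex)" using False by simp
  have F: "(F has_field_derivative e (of_int j * z)) (at z)" for z
    unfolding F_def e_def using nz by (auto intro!: derivative_eq_intros simp: field_simps)
  have "((\<lambda>x. e (of_int j * of_real x)) has_integral (F (of_real (1/2)) - F (of_real (-1/2)))) {-1/2..1/2}"
  proof (rule fundamental_theorem_of_calculus)
    fix x :: real
    show "((\<lambda>x. F (of_real x)) has_vector_derivative e (of_int j * of_real x)) (at x within {-1/2..1/2})"
      using has_vector_derivative_real_field[OF F] by blast
  qed auto
  moreover have "F (of_real (1/2)) = F (of_real (-1/2))"
  proof -
    have "of_int j * of_real (1/2) = of_int j * of_real (-1/2) + (of_int j :: complex)"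
      by (simp add: field_simps)
    thus ?thesis unfolding F_def by (simp only: e_add e_of_int mult_1_right)
  qed
  ultimately show ?thesis using False by simp
qed

lemma has_integral_trigonometric_polynomial:
  "((\<lambda>x. (norm (\<Sum>n<M. c n * e (of_nat n * of_real x)))\<^sup>2)
      has_integral (\<Sum>n<M. (norm (c n))\<^sup>2)) {-1/2..1/2::real}"
proof -
  have eq: "of_real ((norm (\<Sum>n<M. c n * e (of_nat n * of_real x)))\<^sup>2) =
          (\<Sum>n<M. \<Sum>m<M. c n * cnj (c m) * e (of_int (int n - int m) * of_real x))" for x :: real
  proof -
    have cnj_e: "cnj (e (of_nat m * of_real x)) = e (- (of_nat m * of_real x))" for m
      by (simp add: e_def exp_cnj)
    have "e (of_nat n * of_real x) * cnj (e (of_nat m * of_real x)) = e (of_int (int n - int m) * of_real x)" for n m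
      unfolding cnj_e e_add[symmetric] by (simp add: algebra_simps)
    thus ?thesis
      unfolding complex_norm_square cnj_sum sum_product
      by (intro sum.cong refl) (simp add: mult_ac)
  qed
  have "((\<lambda>x. \<Sum>n<M. \<Sum>m<M. c n * cnj (c m) * e (of_int (int n - int m) * of_real x))
      has_integral (\<Sum>n<M. \<Sum>m<M. c n * cnj (c m) * (if int n - int m = 0 then 1 else 0))) {-1/2..1/2::real}"
    by (intro has_integral_sum has_integral_mult_right has_integral_e_of_int) auto
  also have "(\<Sum>n<M. \<Sum>m<M. c n * cnj (c m) * (if int n - int m = 0 then 1 else 0)) = 
     (\<Sum>n<M. of_real ((norm (c n))\<^sup>2))"
    by (intro sum.cong refl) (simp add: complex_norm_square[symmetric] if_distrib cong: if_cong)
  finally have "((\<lambda>x. complex_of_real ((norm (\<Sum>n<M. c n * e (of_nat n * of_real x)))\<^sup>2)) has_integral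
     (\<Sum>n<M. of_real ((norm (c n))\<^sup>2))) {-1/2..1/2}"
    by (simp only: eq)
  from has_integral_linear[OF this bounded_linear_Re] show ?thesis
    by (simp add: o_def del: of_real_power)
qed

text \<open>Only trigonometric polynomials and the majorant \<open>B\<close> are integrated. Uniform
  convergence makes the squared modulus of a long partial sum at most
  \<open>B x + \<epsilon>\<close>, and the exact Parseval identity applies to that partial
  sum.\<close>

lemma sum_norm_square_le_integral:
  fixes c :: "nat \<Rightarrow> complex"
  assumes c: "summable (\<lambda>n. norm (c n))"
    and B: "(B has_integral J) {-1/2..1/2::real}"
    and le: "\<And>x. \<bar>x\<bar> \<le> 1/2 \<Longrightarrow> (norm (\<Sum>n. c n * e (of_nat n * of_real x)))\<^sup>2 \<le> B x"
  shows "(\<Sum>n<M. (norm (c n))\<^sup>2) \<le> J"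
proof (rule field_le_epsilon)
  fix \<epsilon> :: real assume \<epsilon>: "\<epsilon> > 0"
  define u where "u = (\<lambda>x::real. \<Sum>n. c n * e (of_nat n * of_real x))"
  define K where "K = (\<Sum>n. norm (c n))"
  have norm_term: "norm (c n * e (of_nat n * of_real x)) = norm (c n)" for n and x :: real
    by (simp add: norm_mult norm_e)
  have K0: "K \<ge> 0" unfolding K_def by (intro suminf_nonneg c) auto
  have uK: "norm (u x) \<le> K" for x
    unfolding u_def K_def using c by (intro order_trans[OF summable_norm]) (simp_all add: norm_term)
  have uMK: "norm (\<Sum>n<m. c n * e (of_nat n * of_real x)) \<le> K" for m and x :: real
    unfolding K_def
    by (rule order_trans[OF norm_sum]) (simp add: norm_term sum_le_suminf[OF c])
  have "uniform_limit UNIV (\<lambda>m x. \<Sum>n<m. c n * e (of_nat n * of_real x)) u sequentially"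
    unfolding u_def by (rule Weierstrass_m_test[OF _ c]) (simp add: norm_term)
  \<comment> \<open>The squares differ by (|v| - |u|)(|v| + |u|) \<le> \<eta> * 2 K, which is at
    most \<epsilon>. The added 1 covers K = 0.\<close>
  moreover define \<eta> where "\<eta> = \<epsilon> / (2 * K + 1)"
  have \<eta>: "\<eta> > 0" using \<epsilon> K0 by (simp add: \<eta>_def)
  ultimately have "\<forall>\<^sub>F m in sequentially. \<forall>x\<in>UNIV. dist (\<Sum>n<m. c n * e (of_nat n * of_real x)) (u x) < \<eta>"
    by (intro uniform_limitD) auto
  then obtain m0 where m0: "\<And>m x. m \<ge> m0 \<Longrightarrow> norm ((\<Sum>n<m. c n * e (of_nat n * of_real x)) - u x) < \<eta>"
    unfolding eventually_sequentially dist_norm by blast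
  define m where "m = max m0 M"
  have "(\<Sum>n<m. (norm (c n))\<^sup>2) \<le> J + \<epsilon>"
  proof (rule has_integral_le)
    show "((\<lambda>x. (norm (\<Sum>n<m. c n * e (of_nat n * of_real x)))\<^sup>2) has_integral (\<Sum>n<m. (norm (c n))\<^sup>2)) {-1/2..1/2::real}"
      by (rule has_integral_trigonometric_polynomial)
    show "((\<lambda>x. B x + \<epsilon>) has_integral (J + \<epsilon>)) {-1/2..1/2}"
      using has_integral_add[OF B has_integral_const_real[of \<epsilon> "-1/2" "1/2"]] by simp
    fix x :: real assume x: "x \<in> {-1/2..1/2}"
    define v where "v = (\<Sum>n<m. c n * e (of_nat n * of_real x))"
    have "norm (v - u x) \<le> \<eta>" using m0[of m x] by (simp add: m_def v_def less_imp_le)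
    hence "norm v - norm (u x) \<le> \<eta>" using norm_triangle_ineq2[of v "u x"] by linarith
    moreover have "norm v + norm (u x) \<le> 2 * K" using uK[of x] uMK[where m = m and x = x] by (simp add: v_def)
    ultimately have "(norm v - norm (u x)) * (norm v + norm (u x)) \<le> \<eta> * (2 * K)"
      using \<eta> by (intro mult_mono) auto
    also have "\<dots> \<le> \<epsilon>" using \<epsilon> K0 by (simp add: \<eta>_def field_simps)
    finally have "(norm v)\<^sup>2 \<le> (norm (u x))\<^sup>2 + \<epsilon>" by (simp add: power2_eq_square algebra_simps)
    thus "(norm (\<Sum>n<m. c n * e (of_nat n * of_real x)))\<^sup>2 \<le> B x + \<epsilon>"
    proof -
      have "\<bar>x\<bar> \<le> 1/2" using x unfolding atLeastAtMost_iff by linarith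
      from le[OF this] \<open>(norm v)\<^sup>2 \<le> (norm (u x))\<^sup>2 + \<epsilon>\<close> show ?thesis by (simp add: v_def u_def)
    qed
  qed
  moreover have "(\<Sum>n<M. (norm (c n))\<^sup>2) \<le> (\<Sum>n<m. (norm (c n))\<^sup>2)"
    by (rule sum_mono2) (auto simp: m_def)
  ultimately show "(\<Sum>n<M. (norm (c n))\<^sup>2) \<le> J + \<epsilon>" by linarith
qed

section \<open>Estimates for the integrand\<close>

text \<open>The antiderivative arctan(x / sqrt y) / sqrt y varies by at most pi / sqrt y. This
  accounts for the extra exponent 1/2 in the mean square.\<close>

lemma integral_inverse_quadratic:
  assumes "y > 0"
  obtains J where "((\<lambda>x::real. 1 / (x\<^sup>2 + y)) has_integral J) {-1/2..1/2}" "J \<le> pi / sqrt y"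
proof -
  define F where "F = (\<lambda>x. arctan (x / sqrt y) / sqrt y)"
  have "((\<lambda>x. 1 / (x\<^sup>2 + y)) has_integral (F (1/2) - F (-1/2))) {-1/2..1/2}"
  proof (rule fundamental_theorem_of_calculus)
    fix x :: real
    have "x\<^sup>2 + y \<noteq> 0" using assms by (simp add: add_nonneg_eq_0_iff)
    hence "(F has_real_derivative 1 / (x\<^sup>2 + y)) (at x within {-1/2..1/2})"
      unfolding F_def using assms
      by (auto intro!: derivative_eq_intros simp: divide_simps power2_eq_square) (simp add: algebra_simps)?
    thus "(F has_vector_derivative 1 / (x\<^sup>2 + y)) (at x within {-1/2..1/2})"
      by (simp add: has_real_derivative_iff_has_vector_derivative)
  qed auto
  moreover have "F (1/2) - F (-1/2) \<le> pi / sqrt y"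
  proof -
    have "arctan (1/2 / sqrt y) - arctan (- 1/2 / sqrt y) \<le> pi"
      using arctan_bounded[of "1/2 / sqrt y"] arctan_bounded[of "- 1/2 / sqrt y"] by linarith
    thus ?thesis unfolding F_def diff_divide_distrib[symmetric]
      using assms by (intro divide_right_mono) auto
  qed
  ultimately show ?thesis by (rule that)
qed

text \<open>On [0, pi/2] one has s^2 \<le> 3, so sin s \<ge> s - s^3 / 6 \<ge> s / 2.\<close>

lemma abs_sin_ge_half:
  assumes "\<bar>t\<bar> \<le> pi / 2"
  shows "\<bar>t\<bar> / 2 \<le> \<bar>sin t\<bar>"
proof -
  have 1: "s / 2 \<le> sin s" if "0 \<le> s" "s \<le> pi / 2" for s
  proof -
    have "s \<le> 17/10" using that pi_less_4 pi_approx by simp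
    hence "s * s \<le> 17/10 * (17/10)" using that by (intro mult_mono) auto
    hence "s * (s * s) \<le> s * 3" using that by (intro mult_left_mono) auto
    moreover have "\<bar>sin s - s\<bar> \<le> \<bar>s\<bar> ^ 3 / 6"
      using Maclaurin_sin_bound[of s 3] by (simp add: sin_coeff_def eval_nat_numeral)
    moreover have "\<bar>s\<bar> ^ 3 = s * (s * s)" using that by (simp add: power3_eq_cube)
    ultimately show ?thesis by linarith
  qed
  show ?thesis
    using 1[of "\<bar>t\<bar>"] assms by (cases "t \<ge> 0") auto
qed

text \<open>With r = |e(z)|, |1 - e(z)|^2 = (1 - r)^2 + 4 r sin(pi x)^2. The first term controls y^2
  and the second x^2, using r \<ge> exp(-2 pi) for y \<le> 1; the constant is the square of this
  lower bound.\<close>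

lemma norm_one_minus_e_ge:
  obtains c where "c > 0"
    "\<And>z. \<bar>Re z\<bar> \<le> 1/2 \<Longrightarrow> 0 < Im z \<Longrightarrow> Im z \<le> 1 \<Longrightarrow> c * (norm z)\<^sup>2 \<le> (norm (1 - e z))\<^sup>2"
proof (rule that[of "exp (- 4 * pi)"])
  show "exp (- 4 * pi) > 0" by simp
  fix z assume z: "\<bar>Re z\<bar> \<le> 1/2" "0 < Im z" "Im z \<le> 1"
  define x y where "x = Re z" and "y = Im z"
  define r where "r = exp (- (2 * pi * y))"
  have r: "exp (- 2 * pi) \<le> r" "r > 0" using z by (simp_all add: r_def y_def)
  have ez: "e z = of_real r * cis (2 * pi * x)"
    unfolding e_def r_def exp_eq_polar by (simp add: x_def y_def)
  have "(norm (1 - e z))\<^sup>2 = (1 - r * cos (2 * pi * x))\<^sup>2 + (r * sin (2 * pi * x))\<^sup>2"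
    by (simp add: ez cmod_power2)
  also have "\<dots> = 1 - 2 * r * cos (2 * pi * x) + r\<^sup>2 * ((sin (2 * pi * x))\<^sup>2 + (cos (2 * pi * x))\<^sup>2)"
    by (simp add: power2_eq_square algebra_simps del: sin_cos_squared_add sin_cos_squared_add2 sin_cos_squared_add3)
  also have "\<dots> = 1 - 2 * r * cos (2 * (pi * x)) + r\<^sup>2" by (simp add: mult.assoc)
  also have "\<dots> = 1 - 2 * r * (1 - 2 * (sin (pi * x))\<^sup>2) + r\<^sup>2"
    by (simp only: cos_double_sin)
  also have "\<dots> = (1 - r)\<^sup>2 + 4 * r * (sin (pi * x))\<^sup>2" by (simp add: power2_eq_square algebra_simps)
  finally have eq: "(norm (1 - e z))\<^sup>2 = (1 - r)\<^sup>2 + 4 * r * (sin (pi * x))\<^sup>2" .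
  have E: "exp (- 4 * pi) = (exp (- 2 * pi))\<^sup>2" by (simp flip: exp_double)
  have E1: "exp (- 2 * pi) \<le> 1" by simp
  have "exp (- 2 * pi) * y \<le> 1 - r"
  proof -
    have "1 + 2 * pi * y \<le> exp (2 * pi * y)" by (rule exp_ge_add_one_self)
    hence "r * (1 + 2 * pi * y) \<le> r * exp (2 * pi * y)" using r by (intro mult_left_mono) auto
    also have "r * exp (2 * pi * y) = 1" by (simp add: r_def flip: exp_add)
    finally have "r * (2 * pi * y) \<le> 1 - r" by (simp add: algebra_simps)
    moreover have "exp (- 2 * pi) * y \<le> r * (2 * pi * y)"
      using r z pi_gt3 by (intro mult_mono) (auto simp: y_def)
    ultimately show ?thesis by linarith
  qed
  hence "(exp (- 2 * pi) * y)\<^sup>2 \<le> (1 - r)\<^sup>2" using z by (intro power_mono) (auto simp: y_def)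
  moreover have "(exp (- 2 * pi))\<^sup>2 * x\<^sup>2 \<le> 4 * r * (sin (pi * x))\<^sup>2"
  proof -
    have "\<bar>pi * x\<bar> / 2 \<le> \<bar>sin (pi * x)\<bar>"
      using z by (intro abs_sin_ge_half) (simp add: abs_mult x_def)
    moreover have "\<bar>x\<bar> / 2 \<le> \<bar>pi * x\<bar> / 2" using pi_gt3 by (simp add: abs_mult mult_left_le mult_le_cancel_right1)
    ultimately have "\<bar>x\<bar> / 2 \<le> \<bar>sin (pi * x)\<bar>" by linarith
    hence "(\<bar>x\<bar> / 2)\<^sup>2 \<le> \<bar>sin (pi * x)\<bar>\<^sup>2" by (rule power_mono) auto
    hence "x\<^sup>2 \<le> 4 * (sin (pi * x))\<^sup>2" by (simp add: power_divide)
    hence "exp (- 2 * pi) * x\<^sup>2 \<le> r * (4 * (sin (pi * x))\<^sup>2)"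
      using r by (intro mult_mono) auto
    moreover have "(exp (- 2 * pi))\<^sup>2 * x\<^sup>2 \<le> exp (- 2 * pi) * x\<^sup>2"
      using E1 by (intro mult_right_mono) (auto simp: power2_eq_square mult_left_le)
    ultimately show ?thesis by linarith
  qed
  ultimately show "exp (- 4 * pi) * (norm z)\<^sup>2 \<le> (norm (1 - e z))\<^sup>2"
    unfolding eq E cmod_power2[of z] x_def[symmetric] y_def[symmetric]
    by (simp add: distrib_left power_mult_distrib)
qed

section \<open>From the generating function to the mean square\<close>

text \<open>Dividing by 1 - q is the Cauchy product with the geometric series, which turns
  coefficients into their partial sums.\<close>

lemma partial_sums_generating_function:
  fixes b :: "nat \<Rightarrow> complex"
  assumes b: "summable (\<lambda>n. norm (b n * q ^ n))" and q: "norm q < 1"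
  shows "summable (\<lambda>n. norm ((\<Sum>i\<le>n. b i) * q ^ n))"
    and "(\<Sum>n. (\<Sum>i\<le>n. b i) * q ^ n) = (\<Sum>n. b n * q ^ n) / (1 - q)"
proof -
  have g: "summable (\<lambda>n. norm (q ^ n))" using q by (simp add: norm_power summable_geometric)
  have eq: "(\<Sum>i\<le>n. b i * q ^ i * q ^ (n - i)) = (\<Sum>i\<le>n. b i) * q ^ n" for n
    unfolding sum_distrib_right by (intro sum.cong refl) (simp add: mult.assoc flip: power_add)
  have "(\<lambda>n. \<Sum>i\<le>n. b i * q ^ i * q ^ (n - i)) sums ((\<Sum>n. b n * q ^ n) * (\<Sum>n. q ^ n))"
    using Cauchy_product_sums[OF b g] .
  thus "(\<Sum>n. (\<Sum>i\<le>n. b i) * q ^ n) = (\<Sum>n. b n * q ^ n) / (1 - q)"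
    by (simp add: eq sums_iff suminf_geometric[OF q])
  have "summable (\<lambda>n. \<Sum>i\<le>n. norm (b i * q ^ i) * norm (q ^ (n - i)))"
    using b g by (intro summable_Cauchy_product) auto
  thus "summable (\<lambda>n. norm ((\<Sum>i\<le>n. b i) * q ^ n))"
  proof (rule summable_comparison_test_ev[rotated], intro always_eventually allI)
    fix n
    have "norm ((\<Sum>i\<le>n. b i) * q ^ n) = norm (\<Sum>i\<le>n. b i * q ^ i * q ^ (n - i))" by (simp only: eq)
    also have "\<dots> \<le> (\<Sum>i\<le>n. norm (b i * q ^ i) * norm (q ^ (n - i)))"
      by (rule order_trans[OF norm_sum]) (simp only: norm_mult order_refl)
    finally show "norm (norm ((\<Sum>i\<le>n. b i) * q ^ n)) \<le> (\<Sum>i\<le>n. norm (b i * q ^ i) * norm (q ^ (n - i)))"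
      by simp
  qed
qed

text \<open>The two height bounds combine to min(1, |z|^2 / y). Dividing by |1 - e(z)|^2, which is
  at least a constant times |z|^2, leaves a multiple of 1 / (x^2 + y), and the Parseval inequality
  on Im z = y applies.\<close>

lemma cusp_form_partial_sums_laplace:
  fixes b :: "nat \<Rightarrow> complex"
  assumes f: "cusp_form \<kappa> N f" and N: "N > 0" and \<kappa>: "\<kappa> > 0"
    and b: "\<And>z. z \<in> upper_half_plane \<Longrightarrow> ((\<lambda>n. b n * e (of_nat n * z)) has_sum f z) UNIV"
  obtains C where "C \<ge> 0"
    "\<And>y M. 0 < y \<Longrightarrow> y \<le> 1 \<Longrightarrow>
       (\<Sum>n<M. (norm (\<Sum>i\<le>n. b i))\<^sup>2 * exp (- (4 * pi * real n * y))) \<le> C * y powr - ((real \<kappa> + 1) / 2)"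
proof -
  define k where "k = real \<kappa> / 2"
  obtain C where C: "C \<ge> 0"
    "\<And>z. z \<in> upper_half_plane \<Longrightarrow> (norm (f z))\<^sup>2 * Im z powr k \<le> C"
    "\<And>z. z \<in> upper_half_plane \<Longrightarrow> (norm (f z))\<^sup>2 * Im z powr k \<le> C * ((norm z)\<^sup>2 / Im z)"
    using cusp_form_height_bounds[OF f N \<kappa>] unfolding k_def by blast
  obtain c where c: "c > 0"
    "\<And>z. \<bar>Re z\<bar> \<le> 1/2 \<Longrightarrow> 0 < Im z \<Longrightarrow> Im z \<le> 1 \<Longrightarrow> c * (norm z)\<^sup>2 \<le> (norm (1 - e z))\<^sup>2"
    using norm_one_minus_e_ge by blast
  have pow: "e (of_nat n * z) = e z ^ n" for n z
    by (simp add: e_def mult_ac flip: exp_of_nat_mult)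
  show ?thesis
  proof (rule that[of "2 * pi * C / c"])
    show "0 \<le> 2 * pi * C / c" using C(1) c(1) by simp
    fix y :: real and M assume y: "0 < y" "y \<le> 1"
    define d where "d = (\<lambda>n. (\<Sum>i\<le>n. b i) * e (\<i> * of_real y) ^ n)"
    have main: "summable (\<lambda>n. norm ((\<Sum>i\<le>n. b i) * e z ^ n))"
      "(\<Sum>n. (\<Sum>i\<le>n. b i) * e z ^ n) = f z / (1 - e z)" if z: "z \<in> upper_half_plane" for z
    proof -
      have hs: "((\<lambda>n. b n * e z ^ n) has_sum f z) UNIV" using b[OF z] by (simp only: pow)
      \<comment> \<open>Unconditional convergence of a complex series is absolute convergence, as
        the Cauchy product requires.\<close>
      hence s: "summable (\<lambda>n. norm (b n * e z ^ n))"
        using summable_on_iff_abs_summable_on_complex has_sum_imp_summable summable_on_imp_summable by blast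
      have q: "norm (e z) < 1" using z by (simp add: norm_e upper_half_plane_def)
      have "(\<Sum>n. b n * e z ^ n) = f z" using has_sum_imp_sums[OF hs] by (simp add: sums_iff)
      with partial_sums_generating_function[OF s q]
      show "summable (\<lambda>n. norm ((\<Sum>i\<le>n. b i) * e z ^ n))"
        "(\<Sum>n. (\<Sum>i\<le>n. b i) * e z ^ n) = f z / (1 - e z)" by simp_all
    qed
    have d: "summable (\<lambda>n. norm (d n))"
      unfolding d_def using y by (intro main) (simp add: upper_half_plane_def)
    obtain J where J: "((\<lambda>x::real. 1 / (x\<^sup>2 + y)) has_integral J) {-1/2..1/2}" "J \<le> pi / sqrt y"
      using integral_inverse_quadratic[OF y(1)] by blast
    define L where "L = 2 * C / c * y powr - k"
    have L: "L \<ge> 0" using C(1) c(1) by (simp add: L_def)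
    have "(\<Sum>n<M. (norm (d n))\<^sup>2) \<le> L * J"
    proof (rule sum_norm_square_le_integral[OF d])
      show "((\<lambda>x. L * (1 / (x\<^sup>2 + y))) has_integral L * J) {-1/2..1/2}"
        by (intro has_integral_mult_right J)
      fix x :: real assume x: "\<bar>x\<bar> \<le> 1/2"
      define z where "z = of_real x + \<i> * of_real y"
      have z: "z \<in> upper_half_plane" "Re z = x" "Im z = y" using y by (simp_all add: z_def upper_half_plane_def)
      have "d n * e (of_nat n * of_real x) = (\<Sum>i\<le>n. b i) * e z ^ n" for n
        by (simp add: d_def z_def pow e_add power_mult_distrib)
      hence u: "(\<Sum>n. d n * e (of_nat n * of_real x)) = f z / (1 - e z)" using main(2)[OF z(1)] by simp
      have nz: "(norm z)\<^sup>2 = x\<^sup>2 + y\<^sup>2" by (simp add: cmod_power2 z)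
      have nz0: "(norm z)\<^sup>2 > 0" using y by (simp add: nz sum_power2_gt_zero_iff)
      have F: "(norm (f z))\<^sup>2 \<le> C * y powr - k * min 1 ((norm z)\<^sup>2 / y)"
      proof -
        have "(norm (f z))\<^sup>2 * y powr k \<le> C * min 1 ((norm z)\<^sup>2 / y)"
          using C(2,3)[OF z(1)] z(3) by (auto simp: min_def)
        hence "(norm (f z))\<^sup>2 * y powr k * y powr - k \<le> C * min 1 ((norm z)\<^sup>2 / y) * y powr - k"
          by (intro mult_right_mono) auto
        hence "(norm (f z))\<^sup>2 * (y powr k * y powr - k) \<le> C * y powr - k * min 1 ((norm z)\<^sup>2 / y)"
          by (simp only: mult_ac)
        thus ?thesis using y by (simp flip: powr_add)
      qed
      \<comment> \<open>If y \<le> |z|^2, then x^2 + y \<le> 2 |z|^2. Otherwise x^2 \<le> y, and x^2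
        + y \<le> 2 y.\<close>
      have mm: "min 1 ((norm z)\<^sup>2 / y) / (norm z)\<^sup>2 \<le> 2 / (x\<^sup>2 + y)"
      proof (cases "y \<le> (norm z)\<^sup>2")
        case True
        have "x\<^sup>2 + y \<le> 2 * (norm z)\<^sup>2" using True zero_le_power2[of y] zero_le_power2[of x] unfolding nz by argo
        hence "1 / (norm z)\<^sup>2 \<le> 2 / (x\<^sup>2 + y)" using nz0 y by (simp add: divide_simps add_nonneg_pos)
        thus ?thesis using True y by (simp add: min_def)
      next
        case False
        have "x\<^sup>2 \<le> y" using False by (simp add: nz) (smt (verit) zero_le_power2)
        hence "1 / y \<le> 2 / (x\<^sup>2 + y)" using y by (simp add: divide_simps add_nonneg_pos)
        moreover have "(norm z)\<^sup>2 / y \<le> 1" using False y by simp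
        hence "min 1 ((norm z)\<^sup>2 / y) / (norm z)\<^sup>2 = 1 / y" using nz0 by (simp add: min_absorb2)
        ultimately show ?thesis by simp
      qed
      have "(norm (\<Sum>n. d n * e (of_nat n * of_real x)))\<^sup>2 = (norm (f z))\<^sup>2 / (norm (1 - e z))\<^sup>2"
        by (simp add: u norm_divide power_divide)
      also have "\<dots> \<le> (C * y powr - k * min 1 ((norm z)\<^sup>2 / y)) / (c * (norm z)\<^sup>2)"
        using c(2)[of z] x y z c(1) C(1) nz0 by (intro frac_le F) (auto simp: min_def)
      also have "\<dots> = C / c * y powr - k * (min 1 ((norm z)\<^sup>2 / y) / (norm z)\<^sup>2)" by simp
      also have "\<dots> \<le> C / c * y powr - k * (2 / (x\<^sup>2 + y))"
        using C(1) c(1) by (intro mult_left_mono mm) auto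
      finally show "(norm (\<Sum>n. d n * e (of_nat n * of_real x)))\<^sup>2 \<le> L * (1 / (x\<^sup>2 + y))"
        by (simp add: L_def mult_ac)
    qed
    also have "\<dots> \<le> L * (pi / sqrt y)" using L J by (intro mult_left_mono)
    also have "\<dots> = 2 * pi * C / c * y powr - ((real \<kappa> + 1) / 2)"
    proof -
      have half: "pi / sqrt y = pi * y powr - (1/2)"
        unfolding powr_minus powr_half_sqrt[OF less_imp_le[OF y(1)]] by (rule divide_inverse)
      have "y powr - k * y powr - (1/2) = y powr - ((real \<kappa> + 1) / 2)"
        by (simp add: k_def add_divide_distrib flip: powr_add)
      thus ?thesis unfolding L_def half by (simp add: mult_ac)
    qed
    also have "(\<Sum>n<M. (norm (d n))\<^sup>2) = (\<Sum>n<M. (norm (\<Sum>i\<le>n. b i))\<^sup>2 * exp (- (4 * pi * real n * y)))"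
    proof (intro sum.cong refl)
      fix n
      have "(exp (- (2 * pi * y)) ^ n)\<^sup>2 = exp (- (4 * pi * real n * y))"
        by (simp add: mult_ac flip: exp_of_nat_mult power_mult)
      thus "(norm (d n))\<^sup>2 = (norm (\<Sum>i\<le>n. b i))\<^sup>2 * exp (- (4 * pi * real n * y))"
        by (simp add: d_def norm_mult norm_power norm_e power_mult_distrib)
    qed
    finally show "(\<Sum>n<M. (norm (\<Sum>i\<le>n. b i))\<^sup>2 * exp (- (4 * pi * real n * y))) \<le>
       2 * pi * C / c * y powr - ((real \<kappa> + 1) / 2)" .
  qed
qed

text \<open>Take y = 1/X in the smoothed bound: for n \<le> X the weight exp(-4 pi n y) is at least
  exp(-4 pi).\<close>

lemma cusp_form_partial_sums_mean_square:
  fixes b :: "nat \<Rightarrow> complex"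
  assumes f: "cusp_form \<kappa> N f" and N: "N > 0" and \<kappa>: "\<kappa> > 0"
    and b: "\<And>z. z \<in> upper_half_plane \<Longrightarrow> ((\<lambda>n. b n * e (of_nat n * z)) has_sum f z) UNIV"
  obtains C where "C \<ge> 0"
    "\<And>X. X \<ge> 1 \<Longrightarrow> (\<Sum>n\<le>X. (norm (\<Sum>i\<le>n. b i))\<^sup>2) \<le> C * real X powr ((real \<kappa> + 1) / 2)"
proof -
  obtain C where C: "C \<ge> 0"
    "\<And>y M. 0 < y \<Longrightarrow> y \<le> 1 \<Longrightarrow>
       (\<Sum>n<M. (norm (\<Sum>i\<le>n. b i))\<^sup>2 * exp (- (4 * pi * real n * y))) \<le> C * y powr - ((real \<kappa> + 1) / 2)"
    using cusp_form_partial_sums_laplace[OF assms] by blast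
  show ?thesis
  proof (rule that[of "exp (4 * pi) * C"])
    show "exp (4 * pi) * C \<ge> 0" using C(1) by simp
    fix X :: nat assume X: "X \<ge> 1"
    have "(\<Sum>n\<le>X. (norm (\<Sum>i\<le>n. b i))\<^sup>2) \<le>
        (\<Sum>n\<le>X. exp (4 * pi) * ((norm (\<Sum>i\<le>n. b i))\<^sup>2 * exp (- (4 * pi * real n * (1 / real X)))))"
    proof (rule sum_mono)
      fix n assume "n \<in> {..X}"
      hence "real n * (1 / real X) \<le> 1" using X by simp
      hence "4 * pi * (real n * (1 / real X)) \<le> 4 * pi * 1" by (intro mult_left_mono) auto
      hence "1 \<le> exp (4 * pi) * exp (- (4 * pi * real n * (1 / real X)))"
        by (simp only: mult.assoc one_le_exp_iff flip: exp_add)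
      from mult_left_mono[OF this, of "(norm (\<Sum>i\<le>n. b i))\<^sup>2"]
      show "(norm (\<Sum>i\<le>n. b i))\<^sup>2 \<le>
          exp (4 * pi) * ((norm (\<Sum>i\<le>n. b i))\<^sup>2 * exp (- (4 * pi * real n * (1 / real X))))"
        by (simp add: mult_ac)
    qed
    also have "\<dots> = exp (4 * pi) * (\<Sum>n<Suc X. (norm (\<Sum>i\<le>n. b i))\<^sup>2 * exp (- (4 * pi * real n * (1 / real X))))"
      by (simp only: sum_distrib_left lessThan_Suc_atMost)
    also have "\<dots> \<le> exp (4 * pi) * (C * (1 / real X) powr - ((real \<kappa> + 1) / 2))"
      using X by (intro mult_left_mono C(2)) auto
    also have "(1 / real X) powr - ((real \<kappa> + 1) / 2) = real X powr ((real \<kappa> + 1) / 2)"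
      using X by (simp add: powr_divide powr_minus_divide)
    finally show "(\<Sum>n\<le>X. (norm (\<Sum>i\<le>n. b i))\<^sup>2) \<le> exp (4 * pi) * C * real X powr ((real \<kappa> + 1) / 2)"
      by (simp add: mult.assoc)
  qed
qed

text \<open>Split into dyadic blocks: the block from 2^j to 2^(j+1) contributes at most a constant
  times the j-th power of 2^(p - \<alpha>) < 1.\<close>

lemma summable_powr_of_partial_sums_bound:
  fixes u :: "nat \<Rightarrow> real"
  assumes u: "\<And>n. u n \<ge> 0" and C: "C \<ge> 0" and p: "0 < p" "p < \<alpha>"
    and le: "\<And>X. X \<ge> 1 \<Longrightarrow> (\<Sum>n\<le>X. u n) \<le> C * real X powr p"
  shows "summable (\<lambda>n. u n / real n powr \<alpha>)"
proof -
  define r where "r = (2::real) powr (p - \<alpha>)"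
  have r: "0 < r" "r < 1" using p by (auto simp: r_def powr_less_one)
  have dyadic: "(\<Sum>n=2^j..<2^Suc j. u n / real n powr \<alpha>) \<le> C * 2 powr p * r ^ j" for j :: nat
  proof -
    have "(\<Sum>n=2^j..<2^Suc j. u n / real n powr \<alpha>) \<le> (\<Sum>n=2^j..<2^Suc j. u n / (2^j) powr \<alpha>)"
    proof (intro sum_mono divide_left_mono u)
      fix n :: nat assume "n \<in> {2^j..<2^Suc j}"
      hence n: "2 ^ j \<le> n" by simp
      hence n': "2 ^ j \<le> real n" by (metis of_nat_le_iff of_nat_numeral of_nat_power)
      thus "(2^j) powr \<alpha> \<le> real n powr \<alpha>" using p by (intro powr_mono2) auto
      have "0 < real n" using n' by (smt (verit) zero_less_power)
      thus "0 < real n powr \<alpha> * (2^j) powr \<alpha>" by simp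
    qed
    also have "\<dots> = (\<Sum>n=2^j..<2^Suc j. u n) / (2^j) powr \<alpha>" by (simp only: sum_divide_distrib)
    also have "(\<Sum>n=2^j..<2^Suc j. u n) \<le> (\<Sum>n\<le>2^Suc j. u n)" by (intro sum_mono2 u) auto
    also have "\<dots> \<le> C * real (2^Suc j) powr p" by (intro le) auto
    also have "C * real (2^Suc j) powr p / (2^j) powr \<alpha> = C * 2 powr p * r ^ j"
    proof -
      have *: "(2 ^ j) powr x = 2 powr (real j * x)" for x :: real
        by (simp add: powr_powr flip: powr_realpow)
      have "real (2 ^ Suc j) powr p = 2 powr p * 2 powr (real j * p)"
        by (simp add: powr_mult *)
      moreover have "r ^ j = 2 powr (real j * p) / 2 powr (real j * \<alpha>)"
        by (simp add: r_def powr_power algebra_simps flip: powr_diff)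
      ultimately show ?thesis by (simp add: *)
    qed
    finally show ?thesis by (simp add: divide_right_mono)
  qed
  \<comment> \<open>The blocks start at n = 1. The term n = 0 is 0, since
    \<open>0 powr \<alpha>\<close> is 0 and division by 0 gives 0.\<close>
  have bound: "(\<Sum>n<2^J. u n / real n powr \<alpha>) \<le> (\<Sum>j<J. C * 2 powr p * r ^ j)" for J :: nat
  proof (induction J)
    case (Suc J)
    have "(\<Sum>n<2^Suc J. u n / real n powr \<alpha>) =
        (\<Sum>n<2^J. u n / real n powr \<alpha>) + (\<Sum>n=2^J..<2^Suc J. u n / real n powr \<alpha>)"
      unfolding lessThan_atLeast0 by (rule sum.atLeastLessThan_concat[symmetric]) simp_all
    also have "\<dots> \<le> (\<Sum>j<J. C * 2 powr p * r ^ j) + C * 2 powr p * r ^ J"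
      by (intro add_mono Suc dyadic)
    finally show ?case by (simp only: sum.lessThan_Suc)
  qed (simp add: lessThan_Suc)
  have geo: "(\<lambda>j. C * 2 powr p * r ^ j) sums (C * 2 powr p * (1 / (1 - r)))"
    using r by (intro sums_mult geometric_sums) auto
  show ?thesis
  proof (rule bounded_imp_summable)
    show "u n / real n powr \<alpha> \<ge> 0" for n using u by simp
    fix n :: nat
    have "(\<Sum>m\<le>n. u m / real m powr \<alpha>) \<le> (\<Sum>m<2^Suc n. u m / real m powr \<alpha>)"
      using u less_exp[of "Suc n"] by (intro sum_mono2) auto
    also have "\<dots> \<le> (\<Sum>j<Suc n. C * 2 powr p * r ^ j)" by (rule bound)
    also have "\<dots> \<le> (\<Sum>j. C * 2 powr p * r ^ j)"
      using geo C r by (intro sum_le_suminf) (auto simp: sums_iff)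
    finally show "(\<Sum>m\<le>n. u m / real m powr \<alpha>) \<le> (\<Sum>j. C * 2 powr p * r ^ j)" .
  qed
qed

section \<open>Dirichlet series and residues\<close>

lemma has_sum_int_from_one_iff:
  fixes F :: "int \<Rightarrow> 'a :: {comm_monoid_add, topological_space}"
  shows "(F has_sum L) {1..} \<longleftrightarrow> ((\<lambda>n. F (int (Suc n))) has_sum L) UNIV"
  by (rule has_sum_reindex_bij_witness[of _ "\<lambda>n. int (Suc n)" "\<lambda>m. nat (m - 1)"]) auto

lemma sums_int_from_one:
  fixes F :: "int \<Rightarrow> complex"
  assumes "F summable_on {1..}"
  shows "(\<lambda>n. F (int (Suc n))) sums infsum F {1..}"
  using has_sum_infsum[OF assms] unfolding has_sum_int_from_one_iff by (rule has_sum_imp_sums)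

lemma summable_on_int_powr:
  "p > 1 \<Longrightarrow> (\<lambda>n. real_of_int n powr - p) summable_on {1..}"
proof -
  assume "p > 1"
  hence "summable (\<lambda>n. real n powr - p)" by (simp add: summable_real_powr_iff)
  hence "summable (\<lambda>n. real (Suc n) powr - p)" by (subst summable_Suc_iff)
  hence "(\<lambda>n. real (Suc n) powr - p) summable_on UNIV"
    by (intro norm_summable_imp_summable_on) simp
  hence "(\<lambda>n. real_of_int (int (Suc n)) powr - p) summable_on UNIV" by simp
  thus ?thesis unfolding summable_on_def has_sum_int_from_one_iff .
qed

lemma norm_of_int_powr:
  "n \<ge> 0 \<Longrightarrow> norm ((of_int n :: complex) powr w) = real_of_int n powr Re w"
  by (subst norm_powr_real_powr) auto

text \<open>Terms with j \<ge> n vanish. For j < n the numerator is at most D n^q, so the term is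
  bounded by D n^(-4) \<le> D n^(-2) j^(-2); this is why \<open>Re w \<ge> q + 4\<close> is
  required.\<close>

lemma shifted_convolution_summable:
  fixes g h :: "int \<Rightarrow> complex" and D q :: real
  assumes g: "\<And>n. n \<ge> 1 \<Longrightarrow> (norm (g n))\<^sup>2 \<le> D * of_int n powr q"
    and h: "\<And>n. n \<ge> 1 \<Longrightarrow> (norm (h n))\<^sup>2 \<le> D * of_int n powr q"
    and h0: "\<And>n. n \<le> 0 \<Longrightarrow> h n = 0"
    and D: "D \<ge> 0" and q: "q \<ge> 0" and w: "Re w \<ge> q + 4"
  shows "(\<lambda>(n, j). g n * h (n - j) / of_int n powr w) summable_on {1..} \<times> {1..}"
proof -
  have 2: "(\<lambda>n. real_of_int n powr -2) summable_on {1..}" by (rule summable_on_int_powr) simp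
  define G where "G = (\<lambda>(n, j). D * (real_of_int n powr -2 * real_of_int j powr -2))"
  have G: "(\<lambda>x. norm (G x)) summable_on {1..} \<times> {1..}"
    unfolding Infinite_Sum.abs_summable_on_Sigma_iff
  proof (intro conjI ballI)
    fix n :: int assume "n \<in> {1..}"
    show "(\<lambda>j. norm (G (n, j))) summable_on {1..}"
      unfolding G_def using D by (auto intro!: summable_on_cmult_right 2 simp: abs_mult)
  next
    have "(\<Sum>\<^sub>\<infinity>j\<in>{1..}. norm (G (n, j))) = D * (real_of_int n powr -2 * (\<Sum>\<^sub>\<infinity>j\<in>{1..}. real_of_int j powr -2))" for n
      unfolding G_def using D by (simp add: abs_mult infsum_cmult_right')
    hence *: "norm (\<Sum>\<^sub>\<infinity>j\<in>{1..}. norm (G (n, j))) = D * \<bar>\<Sum>\<^sub>\<infinity>j\<in>{1..}. real_of_int j powr -2\<bar> * real_of_int n powr -2" for n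
      using D by (simp add: abs_mult)
    show "(\<lambda>n. norm (\<Sum>\<^sub>\<infinity>j\<in>{1..}. norm (G (n, j)))) summable_on {1..}"
      unfolding * by (intro summable_on_cmult_right 2)
  qed
  have "(\<lambda>x. norm (case x of (n, j) \<Rightarrow> g n * h (n - j) / of_int n powr w)) summable_on {1..} \<times> {1..}"
  proof (rule Infinite_Sum.abs_summable_on_comparison_test[OF G])
    fix x :: "int \<times> int" assume "x \<in> {1..} \<times> {1..}"
    then obtain n j where x: "x = (n, j)" and nj: "n \<ge> 1" "j \<ge> 1" by auto
    have "norm (g n * h (n - j) / of_int n powr w) \<le> D * (real_of_int n powr -2 * real_of_int j powr -2)"
    proof (cases "j < n")
      case False
      thus ?thesis using D by (simp add: h0)
    next
      case True
      have "(norm (h (n - j)))\<^sup>2 \<le> D * real_of_int (n - j) powr q" using True by (intro h) auto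
      also have "\<dots> \<le> D * real_of_int n powr q" using nj True q D by (intro mult_left_mono powr_mono2) auto
      finally have hh: "(norm (h (n - j)))\<^sup>2 \<le> D * real_of_int n powr q" .
      have "2 * (norm (g n) * norm (h (n - j))) \<le> (norm (g n))\<^sup>2 + (norm (h (n - j)))\<^sup>2"
        using sum_squares_bound[of "norm (g n)" "norm (h (n - j))"] by simp
      hence gh: "norm (g n) * norm (h (n - j)) \<le> D * real_of_int n powr q" using g[OF nj(1)] hh by linarith
      have "norm (g n * h (n - j) / of_int n powr w) = norm (g n) * norm (h (n - j)) / real_of_int n powr Re w"
        using nj by (simp add: norm_divide norm_mult norm_of_int_powr)
      also have "\<dots> \<le> D * real_of_int n powr q / real_of_int n powr Re w"
        by (intro divide_right_mono gh) auto
      also have "\<dots> = D * real_of_int n powr (q - Re w)" by (simp add: powr_diff)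
      also have "\<dots> \<le> D * real_of_int n powr (-2 + -2)"
        using nj w D by (intro mult_left_mono powr_mono) auto
      also have "\<dots> = D * (real_of_int n powr -2 * real_of_int n powr -2)" by (simp only: powr_add)
      also have "\<dots> \<le> D * (real_of_int n powr -2 * real_of_int j powr -2)"
        using nj True D by (intro mult_left_mono powr_mono2') auto
      finally show ?thesis .
    qed
    thus "norm (case x of (n, j) \<Rightarrow> g n * h (n - j) / of_int n powr w) \<le> norm (G x)"
      using D by (simp add: x G_def abs_mult)
  qed
  thus ?thesis by (rule abs_summable_summable)
qed

lemma shifted_convolution_sums:
  fixes g h :: "int \<Rightarrow> complex" and D q :: real
  assumes "\<And>n. n \<ge> 1 \<Longrightarrow> (norm (g n))\<^sup>2 \<le> D * of_int n powr q"
    and "\<And>n. n \<ge> 1 \<Longrightarrow> (norm (h n))\<^sup>2 \<le> D * of_int n powr q"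
    and h0: "\<And>n. n \<le> 0 \<Longrightarrow> h n = 0"
    and "D \<ge> 0" and "q \<ge> 0" and "Re w \<ge> q + 4"
  shows "(\<lambda>n. g (int (Suc n)) * (\<Sum>i\<le>n. h (int i)) / of_nat (Suc n) powr w) sums
           (\<Sum>\<^sub>\<infinity>(n, j)\<in>{1..} \<times> {1..}. g n * h (n - j) / of_int n powr w)"
proof -
  define F where "F = (\<lambda>n j. g n * h (n - j) / of_int n powr w)"
  have s: "(\<lambda>(n, j). F n j) summable_on {1..} \<times> {1..}"
    unfolding F_def using assms by (rule shifted_convolution_summable)
  have inner: "infsum (F (int (Suc m))) {1..} = g (int (Suc m)) * (\<Sum>i\<le>m. h (int i)) / of_nat (Suc m) powr w" for m
  proof -
    \<comment> \<open>The substitution i = m + 1 - j runs through 0, ..., m for j from m + 1 down to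
      1; any larger j gives \<open>h\<close> a negative argument.\<close>
    have "infsum (F (int (Suc m))) {1..} = infsum (F (int (Suc m))) ((\<lambda>i. int (Suc m) - int i) ` {..m})"
    proof (rule infsum_cong_neutral)
      fix j assume j: "j \<in> {1..} - (\<lambda>i. int (Suc m) - int i) ` {..m}"
      have "int (Suc m) - j \<le> 0"
      proof (rule ccontr)
        assume "\<not> int (Suc m) - j \<le> 0"
        hence "j = int (Suc m) - int (nat (int (Suc m) - j))" "nat (int (Suc m) - j) \<in> {..m}" using j by auto
        thus False using j by blast
      qed
      thus "F (int (Suc m)) j = 0" by (simp add: F_def h0)
    qed auto
    also have "\<dots> = (\<Sum>i\<le>m. F (int (Suc m)) (int (Suc m) - int i))"
      by (simp add: sum.reindex inj_on_def)
    also have "\<dots> = g (int (Suc m)) * (\<Sum>i\<le>m. h (int i)) / of_nat (Suc m) powr w"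
      by (simp add: F_def sum_distrib_left sum_divide_distrib)
    finally show ?thesis .
  qed
  have "(\<lambda>m. infsum (F (int (Suc m))) {1..}) sums infsum (\<lambda>n. infsum (F n) {1..}) {1..}"
    by (rule sums_int_from_one) (rule summable_on_Sigma_banach[OF s])
  thus ?thesis unfolding inner infsum_Sigma'_banach[OF s] by (simp only: F_def)
qed

section \<open>Continuation by partial summation\<close>

text \<open>The mean value inequality on the segment from n to n + 1 gains one power of n over the
  separate terms.\<close>

lemma norm_powr_diff_Suc_le:
  fixes w :: complex
  assumes n: "n \<ge> 1" and w: "Re w > 0"
  shows "norm ((of_nat n :: complex) powr - w - of_nat (Suc n) powr - w) \<le> norm w * real n powr (- Re w - 1)"
proof -
  define S where "S = closed_segment (of_nat n :: complex) (of_nat (Suc n))"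
  have S: "z \<in> \<real> \<and> Re z \<ge> real n" if "z \<in> S" for z
  proof -
    have "S = closed_segment (of_real (real n)) (of_real (real (Suc n)))" by (simp add: S_def)
    hence "z \<in> of_real ` closed_segment (real n) (real (Suc n))" using that
      by (simp only: closed_segment_of_real)
    thus ?thesis by (auto simp: closed_segment_eq_real_ivl)
  qed
  have "norm ((of_nat n :: complex) powr - w - of_nat (Suc n) powr - w)
      \<le> norm w * real n powr (- Re w - 1) * norm (of_nat n - of_nat (Suc n) :: complex)"
  proof (rule field_differentiable_bound[of S "\<lambda>z. z powr - w" "\<lambda>z. - w * z powr (- w - 1)"])
    show "convex S" "of_nat n \<in> S" "of_nat (Suc n) \<in> S" by (simp_all add: S_def del: of_nat_Suc)
    fix z assume z: "z \<in> S"
    have "z \<notin> \<real>\<^sub>\<le>\<^sub>0" using S[OF z] n by (auto simp: complex_nonpos_Reals_iff)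
    thus "((\<lambda>z. z powr - w) has_field_derivative - w * z powr (- w - 1)) (at z within S)"
      by (rule has_field_derivative_at_within[OF has_field_derivative_powr])
    have "norm (z powr (- w - 1)) = Re z powr (- Re w - 1)"
      using S[OF z] n by (subst norm_powr_real_powr) auto
    also have "\<dots> \<le> real n powr (- Re w - 1)"
      using S[OF z] n w by (intro powr_mono2') auto
    finally show "norm (- w * z powr (- w - 1)) \<le> norm w * real n powr (- Re w - 1)"
      by (simp add: norm_mult mult_left_mono)
  qed
  thus ?thesis by simp
qed

text \<open>The difference of powers is O(|w| n^(-Re w - 1)), so convergence for exponents above
  \<beta> + 1 gives locally uniform convergence already for Re w > \<beta>.\<close>

lemma holomorphic_partial_summation:
  fixes u :: "nat \<Rightarrow> real" and \<beta> :: real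
  assumes u: "\<And>n. u n \<ge> 0" "u 0 = 0" and \<beta>: "\<beta> \<ge> 0"
    and summable: "\<And>\<alpha>. \<alpha> > \<beta> + 1 \<Longrightarrow> summable (\<lambda>n. u n / real n powr \<alpha>)"
  obtains G where "G holomorphic_on {w. Re w > \<beta>}"
    "\<And>w. Re w > \<beta> \<Longrightarrow> (\<lambda>n. of_real (u n) * (of_nat n powr - w - of_nat (Suc n) powr - w)) sums G w"
proof -
  define t where "t = (\<lambda>n w. complex_of_real (u n) * (of_nat n powr - w - of_nat (Suc n) powr - w))"
  have op: "open {w. Re w > \<beta>}" by (rule open_halfspace_Re_gt)
  obtain G where G: "\<forall>w\<in>{w. Re w > \<beta>}. (\<lambda>n. t n w) sums G w \<and> G field_differentiable (at w)"
  proof (rule series_differentiable_comparison_complex[OF op])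
    fix n w assume w: "w \<in> {w. Re w > \<beta>}"
    have "t n holomorphic_on UNIV" unfolding t_def by (intro holomorphic_intros)
    thus "t n field_differentiable at w" by (simp add: holomorphic_on_def)
  next
    fix w0 assume w0: "w0 \<in> {w. Re w > \<beta>}"
    \<comment> \<open>Half the distance to the boundary keeps Re w \<ge> Re w0 - d on the ball, and
      \<alpha> = Re w0 - d + 1 still exceeds \<beta> + 1. \<open>W\<close> bounds |w| on the
      ball.\<close>
    define d where "d = (Re w0 - \<beta>) / 2"
    have d: "d > 0" using w0 by (simp add: d_def)
    define \<alpha> where "\<alpha> = Re w0 - d + 1"
    have \<alpha>: "\<alpha> > \<beta> + 1" using w0 by (simp add: \<alpha>_def d_def field_simps)
    define W where "W = norm w0 + d"
    define H where "H = (\<lambda>n. complex_of_real (W * (u n / real n powr \<alpha>)))"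
    have W: "W \<ge> 0" using d by (simp add: W_def)
    have bound: "norm (t n w) \<le> norm (H n)" if w: "w \<in> ball w0 d \<inter> {w. Re w > \<beta>}" for n w
    proof (cases "n = 0")
      case True
      thus ?thesis using u by (simp add: t_def)
    next
      case False
      have dist: "norm (w0 - w) < d" using w by (simp add: dist_norm)
      have Re: "Re w \<ge> Re w0 - d" using dist abs_Re_le_cmod[of "w0 - w"] by simp
      have nw: "norm w \<le> W" unfolding W_def using dist norm_triangle_ineq3[of w0 w] by linarith
      have "norm (of_nat n powr - w - of_nat (Suc n) powr - w :: complex) \<le> norm w * real n powr (- Re w - 1)"
        using False w \<beta> by (intro norm_powr_diff_Suc_le) auto
      also have "\<dots> \<le> W * real n powr - \<alpha>"
        using False Re nw W by (intro mult_mono powr_mono) (auto simp: \<alpha>_def)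
      finally have "u n * norm (of_nat n powr - w - of_nat (Suc n) powr - w :: complex) \<le> u n * (W * real n powr - \<alpha>)"
        by (intro mult_left_mono u)
      also have "\<dots> = norm (H n)"
        unfolding H_def norm_of_real using u W by (simp add: powr_minus divide_inverse mult_ac)
      finally show ?thesis unfolding t_def norm_mult norm_of_real using u by simp
    qed
    have sumH: "summable H" unfolding H_def
      by (intro summable_of_real summable_mult summable \<alpha>)
    have posH: "range H \<subseteq> \<real>\<^sub>\<ge>\<^sub>0" using u W by (auto simp: H_def)
    have evH: "\<forall>\<^sub>F n in sequentially. \<forall>y\<in>ball w0 d \<inter> {w. Re w > \<beta>}. norm (t n y) \<le> norm (H n)"
      using bound by (intro always_eventually) blast
    show "\<exists>d h. 0 < d \<and> summable h \<and> range h \<subseteq> \<real>\<^sub>\<ge>\<^sub>0 \<and>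
        (\<forall>\<^sub>F n in sequentially. \<forall>y\<in>ball w0 d \<inter> {w. Re w > \<beta>}. norm (t n y) \<le> cmod (h n))"
      by (intro exI[of _ d] exI[of _ H] conjI d sumH posH evH)
  qed
  show ?thesis
  proof (rule that[of G])
    show "G holomorphic_on {w. Re w > \<beta>}"
      using G by (auto simp: holomorphic_on_def field_differentiable_at_within)
    show "(\<lambda>n. of_real (u n) * (of_nat n powr - w - of_nat (Suc n) powr - w)) sums G w" if "Re w > \<beta>" for w
      using G that by (simp add: t_def)
  qed
qed

section \<open>Residues of the continuations\<close>

lemma residue_add_meromorphic:
  assumes "f meromorphic_on {z}" "g meromorphic_on {z}"
  shows "residue (\<lambda>w. f w + g w) z = residue f z + residue g z"
proof -
  obtain r1 where r1: "r1 > 0" "f analytic_on ball z r1 - {z}"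
    using meromorphic_on_isolated_singularity[OF assms(1)] by (auto simp: isolated_singularity_at_def)
  obtain r2 where r2: "r2 > 0" "g analytic_on ball z r2 - {z}"
    using meromorphic_on_isolated_singularity[OF assms(2)] by (auto simp: isolated_singularity_at_def)
  show ?thesis
  proof (rule residue_add[of "ball z (min r1 r2)"])
    show "f holomorphic_on ball z (min r1 r2) - {z}"
      by (rule holomorphic_on_subset[OF analytic_imp_holomorphic[OF r1(2)]]) auto
    show "g holomorphic_on ball z (min r1 r2) - {z}"
      by (rule holomorphic_on_subset[OF analytic_imp_holomorphic[OF r2(2)]]) auto
  qed (use r1 r2 in auto)
qed

text \<open>The difference F - G is meromorphic on a connected half-plane and vanishes near the
  point \<open>p\<close> far to the right. It therefore vanishes off a sparse set, in particular on
  a punctured neighbourhood of \<open>z\<close>, so F has the residue of a holomorphic function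
  there.\<close>

lemma residue_eq_0_of_holomorphic_continuation:
  fixes F G :: "complex \<Rightarrow> complex"
  assumes F: "F meromorphic_on {s. Re s > \<sigma>}" and G: "G holomorphic_on {s. Re s > \<sigma>}"
    and eq: "\<And>s. Re s > c \<Longrightarrow> F s = G s" and z: "Re z > \<sigma>"
  shows "residue F z = 0"
proof -
  define V where "V = {s. Re s > \<sigma>}"
  have V: "open V" "connected V" unfolding V_def
    by (rule open_halfspace_Re_gt, rule convex_connected[OF convex_halfspace_Re_gt])
  have "G meromorphic_on V"
    using G V by (intro analytic_on_imp_meromorphic_on) (auto simp: V_def analytic_on_open)
  hence m: "(\<lambda>s. F s - G s) meromorphic_on V"
    using F by (intro meromorphic_intros) (auto simp: V_def)
  define p where "p = complex_of_real (max \<sigma> c + 1)"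
  have p: "p \<in> V" by (simp add: p_def V_def)
  have "\<forall>\<^sub>F s in nhds p. s \<in> {s. Re s > c}"
    by (intro eventually_nhds_in_open open_halfspace_Re_gt) (simp add: p_def)
  hence ev: "\<forall>\<^sub>F s in at p. F s - G s = 0"
    using eq by (auto simp: eventually_at_filter elim!: eventually_mono)
  have "\<not> eventually (\<lambda>s. F s - G s \<noteq> 0) (at p)"
  proof
    assume "eventually (\<lambda>s. F s - G s \<noteq> 0) (at p)"
    with ev have "eventually (\<lambda>_. False) (at p)" by eventually_elim simp
    thus False by simp
  qed
  hence "eventually (\<lambda>s. F s - G s = 0) (cosparse V)"
    using meromorphic_imp_constant_or_avoid[OF m V, of 0] p V by (auto simp: eventually_cosparse_open_eq)
  hence "eventually (\<lambda>s. F s - G s = 0) (at z)" using z V by (auto simp: eventually_cosparse_open_eq V_def)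
  hence "eventually (\<lambda>s. F s = G s) (at z)" by eventually_elim simp
  hence "residue F z = residue G z" by (intro residue_cong) auto
  also have "\<dots> = 0" by (rule residue_holo[of V]) (use V G z in \<open>auto simp: V_def\<close>)
  finally show ?thesis .
qed

lemma norm_square_add_diff:
  fixes x y :: complex
  shows "of_real ((norm x)\<^sup>2) + x * cnj y + cnj x * y = of_real ((norm (y + x))\<^sup>2) - of_real ((norm y)\<^sup>2)"
  unfolding complex_norm_square by (simp add: algebra_simps)

theorem mainTheorem7:
  fixes \<kappa> N :: nat and k \<sigma> :: real
    and f :: "complex \<Rightarrow> complex" and a :: "int \<Rightarrow> complex"
    and R S T :: "complex \<Rightarrow> complex"
  assumes "N \<ge> 1" and "k = real \<kappa> / 2" and "k > 2"
    and "cusp_form \<kappa> N f"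
    and "\<And>z. z \<in> upper_half_plane \<Longrightarrow> ((\<lambda>n. a n * e (of_int n * z)) has_sum f z) {1..}"
    and "\<And>n. n \<le> 0 \<Longrightarrow> a n = 0"
    and "\<sigma> < 1"
    and "meromorphic_continuation \<sigma>
           (\<lambda>s. \<Sum>\<^sub>\<infinity>n\<in>{1::int..}.
              of_real ((cmod (a n))\<^sup>2) / of_int n powr (s + of_real k - 1)) R"
    and "meromorphic_continuation \<sigma>
           (\<lambda>s. \<Sum>\<^sub>\<infinity>(n, h)\<in>{1::int..} \<times> {1::int..}.
              a n * cnj (a (n - h)) / of_int n powr (s + of_real k - 1)) S"
    and "meromorphic_continuation \<sigma>
           (\<lambda>s. \<Sum>\<^sub>\<infinity>(n, h)\<in>{1::int..} \<times> {1::int..}.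
              cnj (a n) * a (n - h) / of_int n powr (s + of_real k - 1)) T"
  shows "residue R 1 = - residue S 1 - residue T 1"
proof -
  define b where "b = (\<lambda>n. a (int n))"
  define A where "A = (\<lambda>n. \<Sum>i\<le>n. b i)"
  have b0: "b 0 = 0" by (simp add: b_def assms(6))
  have A0: "A 0 = 0" by (simp add: A_def b0)
  have A_Suc: "A (Suc n) = A n + b (Suc n)" for n by (simp add: A_def)
  have b_series: "((\<lambda>n. b n * e (of_nat n * z)) has_sum f z) UNIV" if z: "z \<in> upper_half_plane" for z
  proof -
    have "((\<lambda>n. a n * e (of_int n * z)) has_sum f z) {1..} \<longleftrightarrow> ((\<lambda>n. b n * e (of_nat n * z)) has_sum f z) {1..}"
      by (rule has_sum_reindex_bij_witness[of _ int nat]) (auto simp: b_def)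
    \<comment> \<open>Enlarging the index set adds only n = 0, where \<open>b\<close>
      vanishes.\<close>
    also have "\<dots> \<longleftrightarrow> ((\<lambda>n. b n * e (of_nat n * z)) has_sum f z) UNIV"
      by (rule has_sum_cong_neutral) (auto simp: b0 not_less_eq_eq)
    finally show ?thesis using assms(5)[OF z] by simp
  qed
  have \<kappa>: "\<kappa> > 0" using assms(2,3) by (auto intro!: Nat.gr0I)
  define q where "q = (real \<kappa> + 1) / 2"
  have q: "q = k + 1/2" by (simp add: q_def assms(2) add_divide_distrib)
  obtain C where C: "C \<ge> 0" "\<And>X. X \<ge> 1 \<Longrightarrow> (\<Sum>n\<le>X. (norm (A n))\<^sup>2) \<le> C * real X powr q"
    using cusp_form_partial_sums_mean_square[OF assms(4) _ \<kappa> b_series] assms(1)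
    unfolding A_def q_def by auto
  have summable: "summable (\<lambda>n. (norm (A n))\<^sup>2 / real n powr \<alpha>)" if "\<alpha> > q" for \<alpha>
    by (rule summable_powr_of_partial_sums_bound[OF _ C(1) _ that C(2)]) (use assms(3) q in auto)
  \<comment> \<open>With w = s + k - 1 and q = k + 1/2, the region Re w > q - 1 is Re s >
    1/2.\<close>
  obtain G where G: "G holomorphic_on {w. Re w > q - 1}"
    "\<And>w. Re w > q - 1 \<Longrightarrow>
       (\<lambda>n. of_real ((norm (A n))\<^sup>2) * (of_nat n powr - w - of_nat (Suc n) powr - w)) sums G w"
    using holomorphic_partial_summation[of "\<lambda>n. (norm (A n))\<^sup>2" "q - 1"] A0 summable assms(3) q by auto
  have A_le: "(norm (A n))\<^sup>2 \<le> C * real n powr q" if "n \<ge> 1" for n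
    using member_le_sum[of n "{..n}" "\<lambda>n. (norm (A n))\<^sup>2"] C(2)[OF that] by simp
  define D where "D = 4 * C"
  \<comment> \<open>A polynomial bound for the coefficients is read off from the mean square through
    b(n) = A(n) - A(n - 1), with 4 C coming from |x - y|^2 \<le> 2 |x|^2 + 2 |y|^2.\<close>
  have b_le: "(norm (b n))\<^sup>2 \<le> D * real n powr q" if n: "n \<ge> 1" for n
  proof -
    obtain m where m: "n = Suc m" using n by (cases n) auto
    have "(norm (A m))\<^sup>2 \<le> C * real n powr q"
    proof (cases "m = 0")
      case False
      have "(norm (A m))\<^sup>2 \<le> C * real m powr q" using False by (intro A_le) auto
      also have "\<dots> \<le> C * real n powr q" using C(1) q assms(3) by (intro mult_left_mono powr_mono2) (auto simp: m)
      finally show ?thesis .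
    qed (use C(1) A0 in auto)
    moreover have "(norm (A n))\<^sup>2 \<le> C * real n powr q" by (rule A_le[OF n])
    moreover have "(norm (b n))\<^sup>2 \<le> 2 * (norm (A n))\<^sup>2 + 2 * (norm (A m))\<^sup>2"
    proof -
      have "norm (b n) \<le> norm (A n) + norm (A m)"
        using norm_triangle_ineq4[of "A n" "A m"] by (simp add: m A_Suc)
      hence "(norm (b n))\<^sup>2 \<le> (norm (A n) + norm (A m))\<^sup>2" by (intro power_mono) auto
      also have "\<dots> \<le> 2 * (norm (A n))\<^sup>2 + 2 * (norm (A m))\<^sup>2"
        using sum_squares_bound[of "norm (A n)" "norm (A m)"] by (simp add: power2_sum)
      finally show ?thesis .
    qed
    ultimately show ?thesis unfolding D_def by linarith
  qed
  have a_le: "(norm (a n))\<^sup>2 \<le> D * of_int n powr q" if "n \<ge> 1" for n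
    using b_le[of "nat n"] that by (simp add: b_def)
  have D: "D \<ge> 0" using C(1) by (simp add: D_def)
  have series: "(\<Sum>\<^sub>\<infinity>n\<in>{1::int..}. of_real ((cmod (a n))\<^sup>2) / of_int n powr w)
      + (\<Sum>\<^sub>\<infinity>(n, h)\<in>{1::int..} \<times> {1::int..}. a n * cnj (a (n - h)) / of_int n powr w)
      + (\<Sum>\<^sub>\<infinity>(n, h)\<in>{1::int..} \<times> {1::int..}. cnj (a n) * a (n - h) / of_int n powr w) = G w"
    (is "?R + ?S + ?T = _") if w: "Re w \<ge> q + 4" for w
  proof -
    have "(\<lambda>n. norm (complex_of_real ((cmod (a n))\<^sup>2) / of_int n powr w)) summable_on {1..}"
    proof (rule Infinite_Sum.abs_summable_on_comparison_test)
      show "(\<lambda>n. norm (D * real_of_int n powr -4)) summable_on {1..}"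
        using D by (auto simp: abs_mult intro!: summable_on_cmult_right summable_on_int_powr)
      fix n :: int assume n: "n \<in> {1..}"
      have "norm (complex_of_real ((cmod (a n))\<^sup>2) / of_int n powr w) = (cmod (a n))\<^sup>2 / of_int n powr Re w"
        using n by (simp add: norm_divide norm_power norm_of_int_powr)
      also have "\<dots> \<le> D * of_int n powr q / of_int n powr Re w"
        using a_le[of n] n by (intro divide_right_mono) auto
      also have "\<dots> = D * real_of_int n powr (q - Re w)" by (simp add: powr_diff)
      also have "\<dots> \<le> D * real_of_int n powr -4" using n w D by (intro mult_left_mono powr_mono) auto
      finally show "norm (complex_of_real ((cmod (a n))\<^sup>2) / of_int n powr w) \<le> norm (D * real_of_int n powr -4)"
        using D by simp
    qed
    from sums_int_from_one[OF abs_summable_summable[OF this]]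
    have R: "(\<lambda>n. of_real ((norm (b (Suc n)))\<^sup>2) / of_nat (Suc n) powr w) sums ?R"
      by (simp add: b_def)
    have q0: "q \<ge> 0" using q assms(3) by simp
    have "(\<lambda>n. a (int (Suc n)) * (\<Sum>i\<le>n. cnj (a (int i))) / of_nat (Suc n) powr w) sums ?S"
      by (rule shifted_convolution_sums[of _ D q]) (use a_le D q0 w assms(6) in auto)
    hence S: "(\<lambda>n. b (Suc n) * cnj (A n) / of_nat (Suc n) powr w) sums ?S"
      by (simp add: b_def A_def)
    have "(\<lambda>n. cnj (a (int (Suc n))) * (\<Sum>i\<le>n. a (int i)) / of_nat (Suc n) powr w) sums ?T"
      by (rule shifted_convolution_sums[of _ D q]) (use a_le D q0 w assms(6) in auto)
    hence T: "(\<lambda>n. cnj (b (Suc n)) * A n / of_nat (Suc n) powr w) sums ?T"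
      by (simp add: b_def A_def)
    define g where "g = (\<lambda>n. complex_of_real ((norm (A n))\<^sup>2))"
    have "(\<lambda>n. (of_real ((norm (b (Suc n)))\<^sup>2) + b (Suc n) * cnj (A n) + cnj (b (Suc n)) * A n)
        / of_nat (Suc n) powr w) sums (?R + ?S + ?T)"
      \<comment> \<open>The three numerators now combine into |A(n+1)|^2 - |A(n)|^2, over the common
        denominator (n+1)^w.\<close>
      using sums_add[OF sums_add[OF R S] T] by (simp only: add_divide_distrib)
    hence 1: "(\<lambda>n. g (Suc n) / of_nat (Suc n) powr w - g n / of_nat (Suc n) powr w) sums (?R + ?S + ?T)"
      by (simp only: norm_square_add_diff A_Suc[symmetric] g_def diff_divide_distrib)
    have "summable (\<lambda>n. norm (g n / of_nat n powr w))"
    proof -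
      have "norm (g n / of_nat n powr w) = (norm (A n))\<^sup>2 / real n powr Re w" for n
        using norm_of_int_powr[of "int n" w] by (simp add: g_def norm_divide norm_power)
      thus ?thesis using summable[of "Re w"] w by simp
    qed
    hence g1: "(\<lambda>n. g n / of_nat n powr w) sums (\<Sum>n. g n / of_nat n powr w)"
      by (rule summable_sums[OF summable_norm_cancel])
    \<comment> \<open>The index shift leaves the sum unchanged because
      \<open>g 0 = 0\<close>.\<close>
    hence g2: "(\<lambda>n. g (Suc n) / of_nat (Suc n) powr w) sums (\<Sum>n. g n / of_nat n powr w)"
      by (subst sums_Suc_iff) (simp add: g_def A0)
    have telescope: "x - y + (y - z) = x - z" for x y z :: complex by simp
    \<comment> \<open>Adding the series of \<open>g n / n^w - g (n+1) / (n+1)^w\<close>, whose sum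
      is 0, cancels the leading terms and leaves \<open>g n\<close> times the difference of
      consecutive powers.\<close>
    from sums_add[OF sums_diff[OF g1 g2] 1]
    have "(\<lambda>n. g n / of_nat n powr w - g n / of_nat (Suc n) powr w) sums (?R + ?S + ?T)"
      by (simp only: telescope diff_self add_0_left)
    hence "(\<lambda>n. g n * (of_nat n powr - w - of_nat (Suc n) powr - w)) sums (?R + ?S + ?T)"
      by (simp only: powr_minus divide_inverse right_diff_distrib)
    moreover have "(\<lambda>n. g n * (of_nat n powr - w - of_nat (Suc n) powr - w)) sums G w"
      unfolding g_def using w by (intro G(2)) auto
    ultimately show ?thesis by (rule sums_unique2)
  qed
  obtain cR where cR:
    "\<And>s. Re s > cR \<Longrightarrow> R s = (\<Sum>\<^sub>\<infinity>n\<in>{1::int..}. of_real ((cmod (a n))\<^sup>2) / of_int n powr (s + of_real k - 1))"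
    using assms(8) unfolding meromorphic_continuation_def by blast
  obtain cS where cS:
    "\<And>s. Re s > cS \<Longrightarrow> S s = (\<Sum>\<^sub>\<infinity>(n, h)\<in>{1::int..} \<times> {1::int..}. a n * cnj (a (n - h)) / of_int n powr (s + of_real k - 1))"
    using assms(9) unfolding meromorphic_continuation_def by blast
  obtain cT where cT:
    "\<And>s. Re s > cT \<Longrightarrow> T s = (\<Sum>\<^sub>\<infinity>(n, h)\<in>{1::int..} \<times> {1::int..}. cnj (a n) * a (n - h) / of_int n powr (s + of_real k - 1))"
    using assms(10) unfolding meromorphic_continuation_def by blast
  have mero: "R meromorphic_on {s. Re s > \<sigma>}" "S meromorphic_on {s. Re s > \<sigma>}" "T meromorphic_on {s. Re s > \<sigma>}"
    using assms(8-10) by (simp_all add: meromorphic_continuation_def)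
  have "residue (\<lambda>s. R s + S s + T s) 1 = 0"
  proof (rule residue_eq_0_of_holomorphic_continuation)
    \<comment> \<open>The half-plane must lie inside both the domain of the given continuations and
      that of \<open>G\<close>; it still contains 1.\<close>
    show "(\<lambda>s. R s + S s + T s) meromorphic_on {s. Re s > max \<sigma> (1/2)}"
      by (intro meromorphic_intros mero[THEN meromorphic_on_subset]) auto
    show "(\<lambda>s. G (s + of_real k - 1)) holomorphic_on {s. Re s > max \<sigma> (1/2)}"
      by (rule holomorphic_on_compose_gen[OF _ G(1), unfolded o_def]) (auto intro!: holomorphic_intros simp: q)
    \<comment> \<open>Re w \<ge> q + 4 means Re s \<ge> 11/2, which the bound 6 ensures.\<close>
    show "R s + S s + T s = G (s + of_real k - 1)" if "Re s > max (max cR cS) (max cT 6)" for s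
      using that cR cS cT series[of "s + of_real k - 1"] by (simp add: q)
    show "Re 1 > max \<sigma> (1/2)" using assms(7) by simp
  qed
  moreover have "R meromorphic_on {1}" "S meromorphic_on {1}" "T meromorphic_on {1}"
    using assms(7) by (auto intro: mero[THEN meromorphic_on_subset])
  hence "residue (\<lambda>s. R s + S s + T s) 1 = residue R 1 + residue S 1 + residue T 1"
    by (simp add: residue_add_meromorphic meromorphic_on_add)
  ultimately show ?thesis by (simp add: algebra_simps eq_neg_iff_add_eq_0)
qed

end
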